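(* Let $v$ be a valuation on a field $F$ with valuation ring $O_v$ and value group $\Gamma_v$, let $E/F$ be a finite field extension, and let $R\subseteq E$ be a ring with field of fractions $E$ and $R\cap F=O_v$. Let $P$ be a prime ideal of $O_v$, $H$ the corresponding isolated subgroup of $\Gamma_v$, $S=O_v\setminus P$, and let $u$ be the valuation of $F$ with valuation ring $O_u=S^{-1}O_v$, given by $u(x)=v(x)+H\in\Gamma_u=\Gamma_v/H$ for $x\ne0$. Define $w:E\to\mathcal M(\Gamma_v/H)\cup\{\infty\}$ by $w(0)=\infty$ and, for $0\ne z=xy^{-1}\in E$ with $x\in R$ and $0\ne y\in O_v$, $$w(z)=\{v(a)+H\mid a\in S_x^{R/O_v}\}^{+}+(-v(y)+H).$$ Then $w$ is the filter quasi-valuation on $E$ induced by $(S^{-1}R,u)$.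
   Context: Cut monoid. For a totally ordered abelian group $\Gamma$, a cut $\mathcal A=(\mathcal A^L,\mathcal A^R)$ is a partition of $\Gamma$ into two (possibly empty) subsets with $\alpha<\beta$ for all $\alpha\in\mathcal A^L,\beta\in\mathcal A^R$. $\mathcal M(\Gamma)$ is the set of all cuts, ordered by $\mathcal A\le\mathcal B$ iff $\mathcal A^L\subseteq\mathcal B^L$, with addition $(\mathcal A+\mathcal B)^L=\{\alpha+\beta\mid\alpha\in\mathcal A^L,\beta\in\mathcal B^L\}$; it is a totally ordered abelian monoid. For $S\subseteq\Gamma$, $S^+$ is the smallest cut $\mathcal A$ with $S\subseteq\mathcal A^L$. $\Gamma$ embeds in $\mathcal M(\Gamma)$ via $\alpha\mapsto\{\alpha\}^+=((-\infty,\alpha],(\alpha,\infty))$, and elements of $\Gamma$ are identified with their images; $\mathcal B-\alpha$ means $\mathcal B+(-\alpha)$, and $\infty-\alpha=\infty$, where $\infty$ is an adjoined element greater than all cuts. Isolated subgroups. A subgroup $H\le\Gamma_v$ is isolated if $0\le\gamma\le h\in H$ implies $\gamma\in H$; the isolated subgroup corresponding to a prime $P$ of $O_v$ is $\{\alpha\in\Gamma_v\mid\alpha\ne v(p)\text{ and }\alpha\ne-v(p)\text{ for all }p\in P\}$. $\Gamma_v/H$ is totally ordered by $\overline\gamma\ge\overline0$ iff $\gamma\ge h$ for some $h\in H$. Filter quasi-valuation. For a valuation $v'$ on $F$ with valuation ring $O_{v'}$ and value group $\Gamma_{v'}$, and a ring $R'\subseteq E$ with field of fractions $E$ and $R'\cap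 F=O_{v'}$, put $S_x^{R'/O_{v'}}=\{a\in O_{v'}\mid x\in aR'\}$ for $x\in R'$. The filter quasi-valuation on $E$ induced by $(R',v')$ is the well-defined function $E\to\mathcal M(\Gamma_{v'})\cup\{\infty\}$ sending $0$ to $\infty$ and $rs^{-1}$ ($0\ne r\in R'$, $0\ne s\in O_{v'}$; every nonzero element of $E$ has this form) to $\{v'(a)\mid a\in S_r^{R'/O_{v'}}\}^+-v'(s)$. One has $S^{-1}R\cap F=O_u$. *)

theory Defs
  imports "HOL-Algebra.Algebra"
begin

section \<open>Totally ordered abelian groups and quotients by isolated subgroups\<close>

text \<open>
  Ordered groups are carrier-based, because the quotient by a subgroup has to be one again.
  They are written multiplicatively, as all of \<^theory>\<open>HOL-Algebra.Group\<close>: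
  the group operation is \<open>\<otimes>\<close>, zero is \<open>\<one>\<close>, and the negative of an element is its \<open>inv\<close>.
\<close>

record 'a ord_monoid = "'a monoid" +
  ordle :: "['a, 'a] \<Rightarrow> bool"  (infixl \<open>\<preceq>\<index>\<close> 50)

locale ord_ab_group = comm_group G for G :: "('a, 'b) ord_monoid_scheme" (structure) +
  assumes ord_refl: "a \<in> carrier G \<Longrightarrow> a \<preceq> a"
    and ord_antisym: "\<lbrakk>a \<in> carrier G; b \<in> carrier G; a \<preceq> b; b \<preceq> a\<rbrakk> \<Longrightarrow> a = b"
    and ord_trans: "\<lbrakk>a \<in> carrier G; b \<in> carrier G; c \<in> carrier G; a \<preceq> b; b \<preceq> c\<rbrakk> \<Longrightarrow> a \<preceq> c"
    and ord_total: "\<lbrakk>a \<in> carrier G; b \<in> carrier G\<rbrakk> \<Longrightarrow> a \<preceq> b \<or> b \<preceq> a"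
    and ord_mono: "\<lbrakk>a \<in> carrier G; b \<in> carrier G; c \<in> carrier G; a \<preceq> b\<rbrakk> \<Longrightarrow> c \<otimes> a \<preceq> c \<otimes> b"

text \<open>A coset is nonnegative iff one of its elements is \<open>\<ge> h\<close> for some \<open>h \<in> H\<close>; the order is
  then determined by \<open>A \<le> B\<close> iff \<open>B - A\<close> is nonnegative.\<close>

definition nonneg_coset :: "('a, 'b) ord_monoid_scheme \<Rightarrow> 'a set \<Rightarrow> 'a set \<Rightarrow> bool" where
  "nonneg_coset G H C \<longleftrightarrow> (\<exists>g\<in>C. \<exists>h\<in>H. h \<preceq>\<^bsub>G\<^esub> g)"

definition ord_quotient :: "('a, 'b) ord_monoid_scheme \<Rightarrow> 'a set \<Rightarrow> 'a set ord_monoid" where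
  "ord_quotient G H =
     \<lparr>carrier = carrier (G Mod H), monoid.mult = monoid.mult (G Mod H), one = one (G Mod H),
      ordle = (\<lambda>A B. nonneg_coset G H (B \<otimes>\<^bsub>G Mod H\<^esub> inv\<^bsub>G Mod H\<^esub> A))\<rparr>"

section \<open>The cut monoid\<close>

type_synonym 'a cut = "'a set \<times> 'a set"

definition cuts :: "('a, 'b) ord_monoid_scheme \<Rightarrow> 'a cut set" where
  "cuts G = {(L, R). L \<union> R = carrier G \<and> L \<inter> R = {} \<and>
               (\<forall>a\<in>L. \<forall>b\<in>R. a \<preceq>\<^bsub>G\<^esub> b \<and> a \<noteq> b)}"

definition cut_le :: "'a cut \<Rightarrow> 'a cut \<Rightarrow> bool" where
  "cut_le A B \<longleftrightarrow> fst A \<subseteq> fst B"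

definition cut_add :: "('a, 'b) ord_monoid_scheme \<Rightarrow> 'a cut \<Rightarrow> 'a cut \<Rightarrow> 'a cut" where
  "cut_add G A B =
     (let L = {a \<otimes>\<^bsub>G\<^esub> b | a b. a \<in> fst A \<and> b \<in> fst B} in (L, carrier G - L))"

definition cut_plus :: "('a, 'b) ord_monoid_scheme \<Rightarrow> 'a set \<Rightarrow> 'a cut" where
  "cut_plus G S =
     (THE A. A \<in> cuts G \<and> S \<subseteq> fst A \<and> (\<forall>B\<in>cuts G. S \<subseteq> fst B \<longrightarrow> cut_le A B))"

definition cut_embed :: "('a, 'b) ord_monoid_scheme \<Rightarrow> 'a \<Rightarrow> 'a cut" where
  "cut_embed G a = cut_plus G {a}"

definition cut_monoid :: "('a, 'b) ord_monoid_scheme \<Rightarrow> 'a cut ord_monoid" where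
  "cut_monoid G =
     \<lparr>carrier = cuts G, monoid.mult = cut_add G, one = cut_embed G \<one>\<^bsub>G\<^esub>, ordle = cut_le\<rparr>"

section \<open>Valuations\<close>

datatype 'a with_infty = Fin (the_fin: 'a) | Infty

definition with_infty_set :: "'a set \<Rightarrow> 'a with_infty set" where
  "with_infty_set A = insert Infty (Fin ` A)"

fun infty_add :: "('a, 'b) monoid_scheme \<Rightarrow> 'a with_infty \<Rightarrow> 'a with_infty \<Rightarrow> 'a with_infty" where
  "infty_add G (Fin a) (Fin b) = Fin (a \<otimes>\<^bsub>G\<^esub> b)"
| "infty_add G _ _ = Infty"

fun infty_le :: "('a, 'b) ord_monoid_scheme \<Rightarrow> 'a with_infty \<Rightarrow> 'a with_infty \<Rightarrow> bool" where
  "infty_le G (Fin a) (Fin b) \<longleftrightarrow> a \<preceq>\<^bsub>G\<^esub> b"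
| "infty_le G _ Infty \<longleftrightarrow> True"
| "infty_le G Infty (Fin _) \<longleftrightarrow> False"

text \<open>Valuations are onto, so that \<open>G\<close> is the value group.
  The disjunction in \<open>val_add\<close> is \<open>v (x + y) \<ge> min (v x) (v y)\<close>.\<close>

locale valuation = field K + ord_ab_group G
  for K :: "('a, 'c) ring_scheme" (structure)
    and G :: "('g, 'b) ord_monoid_scheme" (structure)
    and v :: "'a \<Rightarrow> 'g with_infty" +
  assumes val_image: "v ` carrier K = with_infty_set (carrier G)"
    and val_infty: "x \<in> carrier K \<Longrightarrow> v x = Infty \<longleftrightarrow> x = \<zero>\<^bsub>K\<^esub>"
    and val_mult: "\<lbrakk>x \<in> carrier K; y \<in> carrier K\<rbrakk> \<Longrightarrow> v (x \<otimes>\<^bsub>K\<^esub> y) = infty_add G (v x) (v y)"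
    and val_add: "\<lbrakk>x \<in> carrier K; y \<in> carrier K\<rbrakk> \<Longrightarrow>
           infty_le G (v x) (v (x \<oplus>\<^bsub>K\<^esub> y)) \<or> infty_le G (v y) (v (x \<oplus>\<^bsub>K\<^esub> y))"

definition valuation_ring ::
    "('a, 'c) ring_scheme \<Rightarrow> ('g, 'b) ord_monoid_scheme \<Rightarrow> ('a \<Rightarrow> 'g with_infty) \<Rightarrow> 'a set" where
  "valuation_ring K G v = {x \<in> carrier K. infty_le G (Fin \<one>\<^bsub>G\<^esub>) (v x)}"

definition prime_isolated_subgroup ::
    "('g, 'b) ord_monoid_scheme \<Rightarrow> ('a \<Rightarrow> 'g with_infty) \<Rightarrow> 'a set \<Rightarrow> 'g set" where
  "prime_isolated_subgroup G v P =
     {\<alpha> \<in> carrier G. \<forall>p\<in>P. \<forall>\<gamma>. v p = Fin \<gamma> \<longrightarrow> \<alpha> \<noteq> \<gamma> \<and> \<alpha> \<noteq> inv\<^bsub>G\<^esub> \<gamma>}"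

definition coarsened_valuation ::
    "('g, 'b) ord_monoid_scheme \<Rightarrow> 'g set \<Rightarrow> ('a \<Rightarrow> 'g with_infty) \<Rightarrow> 'a \<Rightarrow> 'g set with_infty" where
  "coarsened_valuation G H v x =
     (case v x of Fin \<alpha> \<Rightarrow> Fin (H #>\<^bsub>G\<^esub> \<alpha>) | Infty \<Rightarrow> Infty)"

section \<open>Subrings of a field, localization, and filter quasi-valuations\<close>

definition is_fraction_field_of :: "('a, 'c) ring_scheme \<Rightarrow> 'a set \<Rightarrow> bool" where
  "is_fraction_field_of E R \<longleftrightarrow>
     carrier E = {r \<otimes>\<^bsub>E\<^esub> inv\<^bsub>E\<^esub> s | r s. r \<in> R \<and> s \<in> R - {\<zero>\<^bsub>E\<^esub>}}"

text \<open>Localization of a subring of the field \<open>E\<close>, formed inside \<open>E\<close>.\<close>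

definition localization_in :: "('a, 'c) ring_scheme \<Rightarrow> 'a set \<Rightarrow> 'a set \<Rightarrow> 'a set" where
  "localization_in E S R = {r \<otimes>\<^bsub>E\<^esub> inv\<^bsub>E\<^esub> s | r s. r \<in> R \<and> s \<in> S}"

definition support_set :: "('a, 'c) ring_scheme \<Rightarrow> 'a set \<Rightarrow> 'a set \<Rightarrow> 'a \<Rightarrow> 'a set" where
  "support_set E R O' x = {a \<in> O'. x \<in> a <#\<^bsub>E\<^esub> R}"

text \<open>
  The field \<open>F\<close> is a subset of the carrier of \<open>E\<close>, considered as the field \<open>E\<lparr>carrier := F\<rparr>\<close>.
  Where \<open>the_fin\<close> is used below, its argument is finite: \<open>s \<noteq> 0\<close>, and \<open>r \<noteq> 0\<close> excludes
  \<open>0\<close> from the support set of \<open>r\<close>. As functions on \<open>E\<close> have to be total in HOL, they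
  are taken to be extensional, i.e. undefined outside the carrier of \<open>E\<close>.
\<close>

definition is_filter_quasi_valuation ::
    "('a, 'c) ring_scheme \<Rightarrow> 'a set \<Rightarrow> 'a set \<Rightarrow> ('g, 'b) ord_monoid_scheme \<Rightarrow> ('a \<Rightarrow> 'g with_infty)
      \<Rightarrow> ('a \<Rightarrow> 'g cut with_infty) \<Rightarrow> bool" where
  "is_filter_quasi_valuation E F R G v w \<longleftrightarrow>
     (let O\<^sub>v = valuation_ring (E\<lparr>carrier := F\<rparr>) G v in
      valuation (E\<lparr>carrier := F\<rparr>) G v \<and>
      subring R E \<and> is_fraction_field_of E R \<and> R \<inter> F = O\<^sub>v \<and>
      w \<in> carrier E \<rightarrow>\<^sub>E with_infty_set (carrier (cut_monoid G)) \<and>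
      w \<zero>\<^bsub>E\<^esub> = Infty \<and>
      (\<forall>r \<in> R - {\<zero>\<^bsub>E\<^esub>}. \<forall>s \<in> O\<^sub>v - {\<zero>\<^bsub>E\<^esub>}.
         w (r \<otimes>\<^bsub>E\<^esub> inv\<^bsub>E\<^esub> s) =
           Fin (cut_plus G ((\<lambda>a. the_fin (v a)) ` support_set E R O\<^sub>v r)
                \<otimes>\<^bsub>cut_monoid G\<^esub> cut_embed G (inv\<^bsub>G\<^esub> (the_fin (v s))))))"

text \<open>The map \<open>w\<close> built from \<open>R\<close>, \<open>v\<close> and the subgroup \<open>H\<close>; note that the support sets
  are those of \<open>R\<close> over the valuation ring of \<open>v\<close>, and only the values are reduced modulo \<open>H\<close>.\<close>

definition is_reduced_filter_map ::
    "('a, 'c) ring_scheme \<Rightarrow> 'a set \<Rightarrow> 'a set \<Rightarrow> ('g, 'b) ord_monoid_scheme \<Rightarrow> ('a \<Rightarrow> 'g with_infty)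
      \<Rightarrow> 'g set \<Rightarrow> ('a \<Rightarrow> 'g set cut with_infty) \<Rightarrow> bool" where
  "is_reduced_filter_map E F R G v H w \<longleftrightarrow>
     (let O\<^sub>v = valuation_ring (E\<lparr>carrier := F\<rparr>) G v; GH = ord_quotient G H in
      w \<in> carrier E \<rightarrow>\<^sub>E with_infty_set (carrier (cut_monoid GH)) \<and>
      w \<zero>\<^bsub>E\<^esub> = Infty \<and>
      (\<forall>x \<in> R - {\<zero>\<^bsub>E\<^esub>}. \<forall>y \<in> O\<^sub>v - {\<zero>\<^bsub>E\<^esub>}.
         w (x \<otimes>\<^bsub>E\<^esub> inv\<^bsub>E\<^esub> y) =
           Fin (cut_plus GH ((\<lambda>a. H #>\<^bsub>G\<^esub> the_fin (v a)) ` support_set E R O\<^sub>v x)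
                \<otimes>\<^bsub>cut_monoid GH\<^esub> cut_embed GH (H #>\<^bsub>G\<^esub> inv\<^bsub>G\<^esub> (the_fin (v y))))))"

end

theory Submission
  imports Defs
begin

text \<open>
  The idea is to describe a filter quasi-valuation without choosing a representation of its
  argument: if \<open>z = x y\<^sup>-\<^sup>1\<close>, the value at \<open>z\<close> is the cut generated by all \<open>u(f)\<close> with
  \<open>0 \<noteq> f \<in> F\<close> and \<open>z \<in> f R\<close>. Indeed \<open>z \<in> f R\<close> means \<open>x \<in> (f y) R\<close>; either \<open>f y\<close> lies in the
  valuation ring and belongs to the support set of \<open>x\<close>, or \<open>u(f y) \<le> 0\<close> and the element \<open>1\<close>
  of the support set has a value at least as large. This shows that \<open>w\<close> is well defined.
  It remains to replace \<open>R\<close> by \<open>S\<^sup>-\<^sup>1R\<close>: if \<open>z \<in> f S\<^sup>-\<^sup>1R\<close>, then \<open>z \<in> f s\<^sup>-\<^sup>1 R\<close> for some \<open>s \<in> S\<close>, and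
  \<open>u(f s\<^sup>-\<^sup>1) = u(f)\<close> because \<open>v(s) \<in> H\<close>. So both rings generate the same cut at \<open>z\<close>.
\<close>

section \<open>Ordered groups and cuts\<close>

context ord_ab_group
begin

lemma ord_mono_right:
  "\<lbrakk>a \<in> carrier G; b \<in> carrier G; c \<in> carrier G; a \<preceq> b\<rbrakk> \<Longrightarrow> a \<otimes> c \<preceq> b \<otimes> c"
  using ord_mono[of a b c] by (simp add: m_comm)

lemma ord_cancel_right:
  assumes "a \<in> carrier G" "b \<in> carrier G" "c \<in> carrier G"
  shows "a \<otimes> c \<preceq> b \<otimes> c \<longleftrightarrow> a \<preceq> b"
proof
  assume "a \<otimes> c \<preceq> b \<otimes> c"
  then have "a \<otimes> c \<otimes> inv c \<preceq> b \<otimes> c \<otimes> inv c"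
    using assms ord_mono_right[of "a \<otimes> c" "b \<otimes> c" "inv c"] by simp
  then show "a \<preceq> b" using assms by (simp add: m_assoc)
qed (use assms ord_mono_right in auto)

lemma ord_mult_mono:
  assumes "a \<in> carrier G" "b \<in> carrier G" "c \<in> carrier G" "d \<in> carrier G" "a \<preceq> b" "c \<preceq> d"
  shows "a \<otimes> c \<preceq> b \<otimes> d"
  using ord_trans[of "a \<otimes> c" "b \<otimes> c" "b \<otimes> d"] assms ord_mono ord_mono_right by auto

lemma ord_mult_inv_iff:
  assumes "a \<in> carrier G" "b \<in> carrier G" "c \<in> carrier G"
  shows "a \<preceq> b \<otimes> inv c \<longleftrightarrow> a \<otimes> c \<preceq> b"
  using ord_cancel_right[of a "b \<otimes> inv c" c] assms by (simp add: m_assoc)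

lemma ord_inv_iff:
  assumes "a \<in> carrier G" "b \<in> carrier G"
  shows "inv a \<preceq> inv b \<longleftrightarrow> b \<preceq> a"
  using assms ord_mult_inv_iff[of "inv a" \<one> b] ord_mult_inv_iff[of b \<one> "inv a"]
  by (simp add: m_comm)

lemma ord_inv_one_iff:
  "a \<in> carrier G \<Longrightarrow> inv a \<preceq> \<one> \<longleftrightarrow> \<one> \<preceq> a"
  "a \<in> carrier G \<Longrightarrow> \<one> \<preceq> inv a \<longleftrightarrow> a \<preceq> \<one>"
  using ord_inv_iff[of a \<one>] ord_inv_iff[of \<one> a] by auto

section \<open>Cuts generated by subsets, and their translation\<close>

lemma down_closure_in_cuts:
  assumes "S \<subseteq> carrier G"
  shows "({g \<in> carrier G. \<exists>s\<in>S. g \<preceq> s}, carrier G - {g \<in> carrier G. \<exists>s\<in>S. g \<preceq> s}) \<in> cuts G"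
proof -
  have "a \<preceq> b \<and> a \<noteq> b"
    if "a \<in> carrier G" "s \<in> S" "a \<preceq> s" "b \<in> carrier G" "\<And>t. t \<in> S \<Longrightarrow> \<not> b \<preceq> t" for a b s
    using that assms ord_total[of a b] ord_trans[of b a s] by blast
  then show ?thesis unfolding cuts_def by blast
qed

text \<open>Replaces the definite description by a formula. If \<open>g \<preceq> s\<close> with
  \<open>s \<in> S\<close> and \<open>g\<close> lay in the right half of a cut whose left half
  contains \<open>S\<close>, then \<open>s\<close> would be strictly below \<open>g\<close>. So
  every such left half contains the down closure of \<open>S\<close>.\<close>

lemma cut_plus_eq:
  assumes "S \<subseteq> carrier G"
  shows "cut_plus G S =
    ({g \<in> carrier G. \<exists>s\<in>S. g \<preceq> s}, carrier G - {g \<in> carrier G. \<exists>s\<in>S. g \<preceq> s})"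
proof -
  define L where "L = {g \<in> carrier G. \<exists>s\<in>S. g \<preceq> s}"
  have SL: "S \<subseteq> L" unfolding L_def using assms ord_refl by blast
  have c: "(L, carrier G - L) \<in> cuts G"
    unfolding L_def by (rule down_closure_in_cuts[OF assms])
  have least: "L \<subseteq> fst B" if "B \<in> cuts G" "S \<subseteq> fst B" for B
  proof
    fix g assume "g \<in> L"
    then obtain s where s: "g \<in> carrier G" "s \<in> S" "g \<preceq> s" unfolding L_def by blast
    show "g \<in> fst B"
    proof (rule ccontr)
      assume "g \<notin> fst B"
      then have "s \<in> fst B" "g \<in> snd B" using that s(1,2) unfolding cuts_def by auto
      then have "s \<preceq> g \<and> s \<noteq> g" using that(1) unfolding cuts_def by fastforce
      then show False using s assms ord_antisym by blast
    qed
  qed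
  have "cut_plus G S = (L, carrier G - L)"
    unfolding cut_plus_def cut_le_def
  proof (rule the_equality)
    show "(L, carrier G - L) \<in> cuts G \<and> S \<subseteq> fst (L, carrier G - L) \<and>
        (\<forall>B\<in>cuts G. S \<subseteq> fst B \<longrightarrow> fst (L, carrier G - L) \<subseteq> fst B)"
      using c SL least by simp
  next
    fix A assume A: "A \<in> cuts G \<and> S \<subseteq> fst A \<and> (\<forall>B\<in>cuts G. S \<subseteq> fst B \<longrightarrow> fst A \<subseteq> fst B)"
    have "fst A \<subseteq> fst (L, carrier G - L)" using A c SL by (metis fst_conv)
    then have "fst A = L" using A least[of A] by auto
    moreover have "snd A = carrier G - fst A" using A unfolding cuts_def by auto
    ultimately show "A = (L, carrier G - L)" by (metis prod.collapse)
  qed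
  then show ?thesis unfolding L_def .
qed

lemma cut_plus_in_cuts: "S \<subseteq> carrier G \<Longrightarrow> cut_plus G S \<in> cuts G"
  by (simp only: cut_plus_eq down_closure_in_cuts)

text \<open>Mutually cofinal sets have the same down closure. Generating sets can be compared in
  this way without being equal.\<close>

lemma cut_plus_cofinal:
  assumes "S \<subseteq> carrier G" "T \<subseteq> carrier G"
    and "\<And>s. s \<in> S \<Longrightarrow> \<exists>t\<in>T. s \<preceq> t" and "\<And>t. t \<in> T \<Longrightarrow> \<exists>s\<in>S. t \<preceq> s"
  shows "cut_plus G S = cut_plus G T"
proof -
  have "(\<exists>s\<in>S. g \<preceq> s) \<longleftrightarrow> (\<exists>t\<in>T. g \<preceq> t)" if "g \<in> carrier G" for g
    using assms(3,4) ord_trans[OF that] assms(1,2)[THEN subsetD] by meson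
  then have "{g \<in> carrier G. \<exists>s\<in>S. g \<preceq> s} = {g \<in> carrier G. \<exists>t\<in>T. g \<preceq> t}" by blast
  then show ?thesis by (simp only: cut_plus_eq assms(1,2))
qed

text \<open>Turns the summand that comes from a denominator into a shift of the generators, so that
  the sum is again a generated cut.\<close>

lemma cut_plus_translate:
  assumes "S \<subseteq> carrier G" "c \<in> carrier G"
  shows "cut_plus G S \<otimes>\<^bsub>cut_monoid G\<^esub> cut_embed G c = cut_plus G ((\<lambda>s. s \<otimes> c) ` S)"
proof -
  have sub: "(\<lambda>s. s \<otimes> c) ` S \<subseteq> carrier G" using assms by auto
  have "{a \<otimes> b |a b. a \<in> {g \<in> carrier G. \<exists>s\<in>S. g \<preceq> s} \<and> b \<in> {g \<in> carrier G. \<exists>s\<in>{c}. g \<preceq> s}}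
      = {g \<in> carrier G. \<exists>s\<in>(\<lambda>s. s \<otimes> c) ` S. g \<preceq> s}" (is "?A = ?B")
  proof (intro subset_antisym subsetI)
    fix x assume "x \<in> ?A"
    then obtain a b s where ab: "x = a \<otimes> b" "a \<in> carrier G" "b \<in> carrier G" "s \<in> S"
      "a \<preceq> s" "b \<preceq> c" by auto
    then have "x \<preceq> s \<otimes> c" using assms ord_mult_mono by blast
    then show "x \<in> ?B" using ab by auto
  next
    fix x assume "x \<in> ?B"
    then obtain s where s: "x \<in> carrier G" "s \<in> S" "x \<preceq> s \<otimes> c" by auto
    \<comment> \<open>The two summands of \<open>x\<close> are \<open>x \<otimes> inv c\<close>,
      which lies below \<open>s\<close>, and \<open>c\<close>, the largest element of its own
      cut.\<close>
    then have "x \<otimes> inv c \<preceq> s"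
      using assms ord_mult_inv_iff[of x s "inv c"] by auto
    moreover have "x = (x \<otimes> inv c) \<otimes> c" using s assms by (simp add: m_assoc)
    ultimately show "x \<in> ?A" using s assms ord_refl by blast
  qed
  moreover have "{c} \<subseteq> carrier G" using assms by simp
  ultimately show ?thesis
    unfolding cut_monoid_def cut_embed_def cut_add_def Let_def
    by (simp only: cut_plus_eq[OF sub] cut_plus_eq[OF assms(1)] cut_plus_eq[of "{c}"]
        fst_conv ord_monoid.simps partial_object.simps monoid.simps)
qed

end

section \<open>Isolated subgroups\<close>

locale isolated_subgroup = ord_ab_group G + subgroup H G
  for H :: "'a set" and G :: "('a, 'b) ord_monoid_scheme" (structure) +
  assumes isolated: "\<lbrakk>g \<in> carrier G; h \<in> H; \<one> \<preceq> g; g \<preceq> h\<rbrakk> \<Longrightarrow> g \<in> H"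

text \<open>Closure under the operation is demanded only of nonnegative elements, because primality
  of an ideal speaks only about elements of the valuation ring. The other sign patterns follow from
  isolatedness and inverses.\<close>

lemma (in ord_ab_group) isolated_subgroupI:
  assumes sub: "H \<subseteq> carrier G" and one: "\<one> \<in> H" and inv: "\<And>a. a \<in> H \<Longrightarrow> inv a \<in> H"
    and mult: "\<And>a b. \<lbrakk>a \<in> H; b \<in> H; \<one> \<preceq> a; \<one> \<preceq> b\<rbrakk> \<Longrightarrow> a \<otimes> b \<in> H"
    and isol: "\<And>g h. \<lbrakk>g \<in> carrier G; h \<in> H; \<one> \<preceq> g; g \<preceq> h\<rbrakk> \<Longrightarrow> g \<in> H"
  shows "isolated_subgroup H G"
proof -
  have inv': "a \<in> H" if "inv a \<in> H" "a \<in> carrier G" for a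
    using inv[OF that(1)] that(2) by simp
  \<comment> \<open>The product lies between \<open>b \<preceq> \<one>\<close> and \<open>a\<close>.
    Hence either it or its inverse is squeezed between \<open>\<one>\<close> and an element of
    \<open>H\<close>.\<close>
  have opp: "a \<otimes> b \<in> H" if "a \<in> H" "b \<in> H" "\<one> \<preceq> a" "b \<preceq> \<one>" for a b
  proof -
    have c: "a \<in> carrier G" "b \<in> carrier G" using that sub by auto
    show ?thesis
    proof (cases "\<one> \<preceq> a \<otimes> b")
      case True
      have "a \<otimes> b \<preceq> a" using ord_mono[of b \<one> a] that c by simp
      then show ?thesis using isol[of "a \<otimes> b" a] that c True by simp
    next
      case False
      then have 1: "\<one> \<preceq> inv (a \<otimes> b)" using ord_total[of \<one> "a \<otimes> b"] c ord_inv_one_iff by auto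
      have "b \<preceq> a \<otimes> b" using ord_mono_right[of \<one> a b] that c by simp
      then have "inv (a \<otimes> b) \<preceq> inv b" using ord_inv_iff c by simp
      then have "inv (a \<otimes> b) \<in> H" using isol[OF _ inv[OF that(2)] 1] c by simp
      then show ?thesis using inv'[of "a \<otimes> b"] c by simp
    qed
  qed
  have closed: "a \<otimes> b \<in> H" if "a \<in> H" "b \<in> H" for a b
  proof -
    have c: "a \<in> carrier G" "b \<in> carrier G" using that sub by auto
    consider "\<one> \<preceq> a" "\<one> \<preceq> b" | "\<one> \<preceq> a" "b \<preceq> \<one>" | "a \<preceq> \<one>" "\<one> \<preceq> b" | "a \<preceq> \<one>" "b \<preceq> \<one>"
      using c ord_total by blast
    then show ?thesis
    proof cases
      case 3
      then show ?thesis using opp[of b a] that m_comm c by simp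
    next
      case 4
      then have "inv a \<otimes> inv b \<in> H"
        using mult[OF inv[OF that(1)] inv[OF that(2)]] c ord_inv_one_iff(2) by simp
      then show ?thesis using inv'[of "a \<otimes> b"] c by (simp add: inv_mult)
    qed (use mult opp that in auto)
  qed
  have "subgroup H G" using subgroupI[OF sub] one inv closed by blast
  then show ?thesis
    by (intro isolated_subgroup.intro isolated_subgroup_axioms.intro)
      (simp_all only: isol ord_ab_group_axioms)
qed

section \<open>Quotients by isolated subgroups and coarsened valuations\<close>

context isolated_subgroup
begin

lemma normal_H: "H \<lhd> G"
  using subgroup_axioms by (simp add: subgroup_imp_normal)

lemma ord_quotient_simps:
  "carrier (ord_quotient G H) = rcosets H"
  "one (ord_quotient G H) = H"
  "monoid.mult (ord_quotient G H) = set_mult G"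
  by (simp_all add: ord_quotient_def FactGroup_def)

lemma rcoset_ex: "A \<in> rcosets H \<Longrightarrow> \<exists>a\<in>carrier G. A = H #> a"
  by (auto simp: RCOSETS_def)

lemma rcoset_mem: "a \<in> carrier G \<Longrightarrow> H #> a \<in> rcosets H"
  by (auto simp: RCOSETS_def)

lemma rcoset_mult:
  "\<lbrakk>a \<in> carrier G; b \<in> carrier G\<rbrakk> \<Longrightarrow> (H #> a) <#> (H #> b) = H #> (a \<otimes> b)"
  using normal.rcos_sum[OF normal_H] by simp

text \<open>The order is nonnegativity of the coset of \<open>b \<otimes> inv a\<close>. A witness
  in that coset differs from \<open>b \<otimes> inv a\<close> by some \<open>k \<in> H\<close>, and
  \<open>k\<close> can be absorbed into \<open>h\<close>. This makes the order testable on
  representatives.\<close>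

lemma ord_quotient_le:
  assumes "a \<in> carrier G" "b \<in> carrier G"
  shows "(H #> a) \<preceq>\<^bsub>ord_quotient G H\<^esub> (H #> b) \<longleftrightarrow> (\<exists>h\<in>H. h \<otimes> a \<preceq> b)"
proof -
  have "inv\<^bsub>G Mod H\<^esub> (H #> a) = H #> inv a"
    using normal.inv_FactGroup[OF normal_H] normal.rcos_inv[OF normal_H] assms
    by (simp add: carrier_FactGroup rcoset_mem)
  then have "(H #> a) \<preceq>\<^bsub>ord_quotient G H\<^esub> (H #> b) \<longleftrightarrow> nonneg_coset G H (H #> (b \<otimes> inv a))"
    using assms by (simp add: ord_quotient_def rcoset_mult)
  also have "\<dots> \<longleftrightarrow> (\<exists>h\<in>H. \<exists>k\<in>H. h \<preceq> k \<otimes> (b \<otimes> inv a))"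
    by (auto simp: nonneg_coset_def r_coset_def)
  also have "\<dots> \<longleftrightarrow> (\<exists>h\<in>H. h \<otimes> a \<preceq> b)"
  proof
    assume "\<exists>h\<in>H. \<exists>k\<in>H. h \<preceq> k \<otimes> (b \<otimes> inv a)"
    then obtain h k where hk: "h \<in> H" "k \<in> H" "h \<preceq> k \<otimes> (b \<otimes> inv a)" by auto
    then have "inv k \<otimes> h \<preceq> inv k \<otimes> (k \<otimes> (b \<otimes> inv a))"
      using assms by (intro ord_mono) auto
    then have "inv k \<otimes> h \<preceq> b \<otimes> inv a" using assms hk by (simp add: m_assoc[symmetric])
    then have "inv k \<otimes> h \<otimes> a \<preceq> b" using ord_mult_inv_iff assms hk by simp
    then show "\<exists>h\<in>H. h \<otimes> a \<preceq> b" using hk by blast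
  next
    assume "\<exists>h\<in>H. h \<otimes> a \<preceq> b"
    then obtain h where "h \<in> H" "h \<otimes> a \<preceq> b" by auto
    then have "h \<preceq> \<one> \<otimes> (b \<otimes> inv a)" using ord_mult_inv_iff assms by simp
    then show "\<exists>h\<in>H. \<exists>k\<in>H. h \<preceq> k \<otimes> (b \<otimes> inv a)"
      using \<open>h \<in> H\<close> subgroup.one_closed[OF subgroup_axioms] by blast
  qed
  finally show ?thesis .
qed

lemma ord_quotient_le_imp:
  "\<lbrakk>a \<in> carrier G; b \<in> carrier G; a \<preceq> b\<rbrakk> \<Longrightarrow> (H #> a) \<preceq>\<^bsub>ord_quotient G H\<^esub> (H #> b)"
  by (auto simp: ord_quotient_le intro: bexI[of _ \<one>])

text \<open>The group laws are those of the factor group. Of the order axioms, antisymmetry is the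
  one that rests on isolatedness; the others carry over through representatives.\<close>

lemma ord_ab_group_ord_quotient: "ord_ab_group (ord_quotient G H)"
proof -
  interpret Q: comm_group "G Mod H"
    using abelian_FactGroup subgroup_axioms by blast
  have [simp]: "carrier (G Mod H) = rcosets H" by (simp add: FactGroup_def)
  have cg: "comm_group (ord_quotient G H)"
  proof (rule comm_groupI)
    fix A assume "A \<in> carrier (ord_quotient G H)"
    then show "\<exists>B\<in>carrier (ord_quotient G H). B \<otimes>\<^bsub>ord_quotient G H\<^esub> A = \<one>\<^bsub>ord_quotient G H\<^esub>"
      using Q.l_inv_ex[of A] by (simp add: ord_quotient_simps)
  qed (use Q.m_closed Q.one_closed Q.m_assoc Q.m_comm Q.l_one in \<open>simp_all add: ord_quotient_simps\<close>)
  interpret Q': comm_group "ord_quotient G H" by (fact cg)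
  show ?thesis
  proof (unfold_locales; unfold ord_quotient_simps)
    fix A assume A: "A \<in> rcosets H"
    then show "A \<preceq>\<^bsub>ord_quotient G H\<^esub> A" using rcoset_ex ord_quotient_le_imp ord_refl by blast
  next
    fix A B assume A: "A \<in> rcosets H" "B \<in> rcosets H"
      "A \<preceq>\<^bsub>ord_quotient G H\<^esub> B" "B \<preceq>\<^bsub>ord_quotient G H\<^esub> A"
    obtain a b where ab: "a \<in> carrier G" "A = H #> a" "b \<in> carrier G" "B = H #> b" 
      using A rcoset_ex by meson
    obtain h k where hk: "h \<in> H" "h \<otimes> a \<preceq> b" "k \<in> H" "k \<otimes> b \<preceq> a"
      using A ab ord_quotient_le by auto
    \<comment> \<open>The two comparisons enclose \<open>b \<otimes> inv a\<close> between
      \<open>h\<close> and \<open>inv k\<close>. Dividing by \<open>h\<close> makes the lower bound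
      \<open>\<one>\<close>, so that isolatedness applies and both cosets agree.\<close>
    have le: "h \<preceq> b \<otimes> inv a" using ord_mult_inv_iff ab hk by simp
    have "b \<otimes> k \<preceq> a" using hk ab by (simp add: m_comm)
    then have "b \<preceq> a \<otimes> inv k" using ord_mult_inv_iff ab hk by simp
    then have "b \<preceq> inv k \<otimes> a" using hk ab by (simp add: m_comm)
    then have "b \<otimes> inv a \<preceq> inv k"
      using ord_mult_inv_iff[of b "inv k" "inv a"] ab hk by simp
    then have "(b \<otimes> inv a) \<otimes> inv h \<preceq> inv k \<otimes> inv h"
      using ord_mono_right[of "b \<otimes> inv a" "inv k" "inv h"] ab hk by simp
    moreover have "\<one> \<preceq> (b \<otimes> inv a) \<otimes> inv h"
      using ord_mult_inv_iff[of \<one> "b \<otimes> inv a" h] ab hk le by simp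
    ultimately have "(b \<otimes> inv a) \<otimes> inv h \<in> H"
      using isolated[of "(b \<otimes> inv a) \<otimes> inv h" "inv k \<otimes> inv h"] ab hk by simp
    then have "(b \<otimes> inv a) \<otimes> inv h \<otimes> h \<in> H" using hk by blast
    then have "b \<otimes> inv a \<in> H" using ab hk by (simp add: m_assoc)
    moreover have "b = (b \<otimes> inv a) \<otimes> a" using ab by (simp add: m_assoc)
    ultimately have "b \<in> H #> a" unfolding r_coset_def by blast
    then show "A = B" using ab repr_independence subgroup_axioms by blast
  next
    fix A B C assume A: "A \<in> rcosets H" "B \<in> rcosets H" "C \<in> rcosets H"
      "A \<preceq>\<^bsub>ord_quotient G H\<^esub> B" "B \<preceq>\<^bsub>ord_quotient G H\<^esub> C"
    obtain a b c where ab: "a \<in> carrier G" "A = H #> a" "b \<in> carrier G" "B = H #> b" 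
      "c \<in> carrier G" "C = H #> c" 
      using A rcoset_ex by meson
    obtain h k where hk: "h \<in> H" "h \<otimes> a \<preceq> b" "k \<in> H" "k \<otimes> b \<preceq> c"
      using A ab ord_quotient_le by auto
    have "k \<otimes> (h \<otimes> a) \<preceq> k \<otimes> b" using ord_mono ab hk by simp
    then have "(k \<otimes> h) \<otimes> a \<preceq> c"
      using ord_trans[of "k \<otimes> (h \<otimes> a)" "k \<otimes> b" c] ab hk by (simp add: m_assoc)
    then show "A \<preceq>\<^bsub>ord_quotient G H\<^esub> C" using ab hk ord_quotient_le by auto
  next
    fix A B assume A: "A \<in> rcosets H" "B \<in> rcosets H"
    then obtain a b where ab: "a \<in> carrier G" "A = H #> a" "b \<in> carrier G" "B = H #> b" 
      using rcoset_ex by meson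
    then show "A \<preceq>\<^bsub>ord_quotient G H\<^esub> B \<or> B \<preceq>\<^bsub>ord_quotient G H\<^esub> A"
      using ord_total[of a b] ord_quotient_le_imp by auto
  next
    fix A B C assume A: "A \<in> rcosets H" "B \<in> rcosets H" "C \<in> rcosets H"
      "A \<preceq>\<^bsub>ord_quotient G H\<^esub> B"
    obtain a b c where ab: "a \<in> carrier G" "A = H #> a" "b \<in> carrier G" "B = H #> b" 
      "c \<in> carrier G" "C = H #> c" 
      using A rcoset_ex by meson
    obtain h where hk: "h \<in> H" "h \<otimes> a \<preceq> b"
      using A ab ord_quotient_le by auto
    have "c \<otimes> (h \<otimes> a) \<preceq> c \<otimes> b" using ord_mono ab hk by simp
    moreover have "c \<otimes> (h \<otimes> a) = h \<otimes> (c \<otimes> a)" using ab hk by (simp add: m_lcomm)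
    ultimately have "(H #> (c \<otimes> a)) \<preceq>\<^bsub>ord_quotient G H\<^esub> (H #> (c \<otimes> b))"
      using ab hk ord_quotient_le[of "c \<otimes> a" "c \<otimes> b"] by auto
    then show "C <#> A \<preceq>\<^bsub>ord_quotient G H\<^esub> C <#> B" using ab by (simp add: rcoset_mult)
  qed
qed

lemma inv_ord_quotient:
  assumes "a \<in> carrier G"
  shows "inv\<^bsub>ord_quotient G H\<^esub> (H #> a) = H #> inv a"
proof -
  interpret Q: ord_ab_group "ord_quotient G H" by (rule ord_ab_group_ord_quotient)
  show ?thesis
    by (rule Q.comm_inv_char)
      (use assms in \<open>simp_all add: ord_quotient_simps rcoset_mem rcoset_mult coset_mult_one subset\<close>)
qed

text \<open>The projection onto the quotient is a monotone surjective homomorphism, and composition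
  with such a map preserves the valuation axioms.\<close>

lemma valuation_coarsened:
  assumes "valuation K G v"
  shows "valuation K (ord_quotient G H) (coarsened_valuation G H v)"
proof -
  interpret V: valuation K G v by fact
  interpret Q: ord_ab_group "ord_quotient G H" by (rule ord_ab_group_ord_quotient)
  have fin: "g \<in> carrier G" if "v x = Fin g" "x \<in> carrier K" for x g
  proof -
    have "Fin g \<in> with_infty_set (carrier G)"
      using V.val_image imageI[OF that(2), of v] that(1) by simp
    then show ?thesis by (auto simp: with_infty_set_def)
  qed
  have mono: "infty_le (ord_quotient G H) (coarsened_valuation G H v x) (coarsened_valuation G H v y)"
    if "x \<in> carrier K" "y \<in> carrier K" "infty_le G (v x) (v y)" for x y
    using that fin[of x] fin[of y] ord_quotient_le_imp
    by (cases "v x"; cases "v y"; simp add: coarsened_valuation_def)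
  have fieldK: "field K" by unfold_locales
  show ?thesis
  proof (intro valuation.intro valuation_axioms.intro)
    have "coarsened_valuation G H v ` carrier K
      = (\<lambda>t. case t of Fin \<alpha> \<Rightarrow> Fin (H #> \<alpha>) | Infty \<Rightarrow> Infty) ` (v ` carrier K)"
      by (auto simp: coarsened_valuation_def)
    also have "\<dots> = with_infty_set (carrier (ord_quotient G H))"
      unfolding V.val_image by (force simp: with_infty_set_def ord_quotient_simps RCOSETS_def)
    finally show "coarsened_valuation G H v ` carrier K = with_infty_set (carrier (ord_quotient G H))" .
    show "coarsened_valuation G H v x = Infty \<longleftrightarrow> x = \<zero>\<^bsub>K\<^esub>" if "x \<in> carrier K" for x
      using V.val_infty[OF that] by (auto simp: coarsened_valuation_def split: with_infty.splits)
    show "coarsened_valuation G H v (x \<otimes>\<^bsub>K\<^esub> y) = infty_add (ord_quotient G H)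
      (coarsened_valuation G H v x) (coarsened_valuation G H v y)"
      if "x \<in> carrier K" "y \<in> carrier K" for x y
      using V.val_mult[OF that] fin[of x] fin[of y] that
      by (cases "v x"; cases "v y"; simp add: coarsened_valuation_def ord_quotient_simps rcoset_mult)
    show "infty_le (ord_quotient G H) (coarsened_valuation G H v x) (coarsened_valuation G H v (x \<oplus>\<^bsub>K\<^esub> y))
      \<or> infty_le (ord_quotient G H) (coarsened_valuation G H v y) (coarsened_valuation G H v (x \<oplus>\<^bsub>K\<^esub> y))"
      if "x \<in> carrier K" "y \<in> carrier K" for x y
    proof -
      have "x \<oplus>\<^bsub>K\<^esub> y \<in> carrier K"
        using that fieldK by (meson fieldE(1) cring.axioms(1) ring.ring_simprules(1))
      then show ?thesis using V.val_add[OF that] mono that by blast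
    qed
  qed (use fieldK Q.ord_ab_group_axioms in auto)
qed

end

section \<open>Localizations inside a field\<close>

context field
begin

lemma frac_closed: "\<lbrakk>r \<in> carrier R; s \<in> carrier R - {\<zero>}\<rbrakk> \<Longrightarrow> r \<otimes> inv s \<in> carrier R"
  using field_Units by simp

lemma inv_nonzero: "s \<in> carrier R - {\<zero>} \<Longrightarrow> inv s \<in> carrier R - {\<zero>}"
  using field_Units Units_inv_Units by blast

lemma frac_eq_iff:
  assumes "r \<in> carrier R" "s \<in> carrier R - {\<zero>}" "t \<in> carrier R"
  shows "r \<otimes> inv s = t \<longleftrightarrow> r = t \<otimes> s"
proof -
  have s: "s \<in> Units R" "inv s \<in> carrier R" "s \<in> carrier R"
    using assms(2) inv_nonzero field_Units by auto
  have "r \<otimes> inv s \<otimes> s = r" "t \<otimes> s \<otimes> inv s = t"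
    using s assms by (simp_all add: m_assoc Units_l_inv Units_r_inv)
  then show ?thesis by metis
qed

lemma frac_mult:
  assumes "a \<in> carrier R" "b \<in> carrier R" "s \<in> carrier R - {\<zero>}" "t \<in> carrier R - {\<zero>}"
  shows "(a \<otimes> inv s) \<otimes> (b \<otimes> inv t) = (a \<otimes> b) \<otimes> inv (s \<otimes> t)"
proof -
  have c: "s \<in> carrier R" "t \<in> carrier R" "inv s \<in> carrier R" "inv t \<in> carrier R"
    using assms(3,4) inv_nonzero by auto
  have "s \<otimes> t \<otimes> (inv s \<otimes> inv t) = (s \<otimes> inv s) \<otimes> (t \<otimes> inv t)"
    using c by (simp add: m_ac)
  also have "\<dots> = \<one>" using assms(3,4) field_Units Units_r_inv by simp
  finally have "inv (s \<otimes> t) = inv s \<otimes> inv t" using c by (intro comm_inv_char) simp_all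
  then show ?thesis using assms(1,2) c by (simp add: m_ac)
qed

lemma frac_add:
  assumes "a \<in> carrier R" "b \<in> carrier R" "s \<in> carrier R - {\<zero>}" "t \<in> carrier R - {\<zero>}"
  shows "(a \<otimes> inv s) \<oplus> (b \<otimes> inv t) = (a \<otimes> t \<oplus> b \<otimes> s) \<otimes> inv (s \<otimes> t)"
proof -
  have st: "s \<otimes> t \<in> carrier R - {\<zero>}" using assms integral[of s t] by auto
  have c: "a \<otimes> inv s \<in> carrier R" "b \<otimes> inv t \<in> carrier R" using assms frac_closed by auto
  have "(a \<otimes> inv s) \<otimes> s = a" "(b \<otimes> inv t) \<otimes> t = b"
    using assms c frac_eq_iff by metis+
  then have "((a \<otimes> inv s) \<oplus> (b \<otimes> inv t)) \<otimes> (s \<otimes> t) = a \<otimes> t \<oplus> b \<otimes> s"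
    using assms c by (smt (verit) Diff_iff l_distr m_assoc m_comm m_closed)
  moreover have "a \<otimes> t \<oplus> b \<otimes> s \<in> carrier R" using assms by simp
  moreover have "(a \<otimes> inv s) \<oplus> (b \<otimes> inv t) \<in> carrier R" using c by simp
  ultimately show ?thesis using frac_eq_iff st by metis
qed

lemma localization_in_supset:
  assumes "subring A R" "\<one> \<in> S"
  shows "A \<subseteq> localization_in R S A"
proof
  fix a assume a: "a \<in> A"
  then have "a = a \<otimes> inv \<one>" using subringE(1)[OF assms(1)] by auto
  then show "a \<in> localization_in R S A" using a assms(2) unfolding localization_in_def by blast
qed

lemma subring_localization_in:
  assumes A: "subring A R" and S: "S \<subseteq> A - {\<zero>}" "\<one> \<in> S"
    and S_mult: "\<And>s t. \<lbrakk>s \<in> S; t \<in> S\<rbrakk> \<Longrightarrow> s \<otimes> t \<in> S"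
  shows "subring (localization_in R S A) R"
proof (rule subringI)
  note A' = subringE[OF A]
  have car: "a \<in> carrier R" "s \<in> carrier R - {\<zero>}" if "a \<in> A" "s \<in> S" for a s
    using that A'(1) S by auto
  show "localization_in R S A \<subseteq> carrier R"
    using car frac_closed by (auto simp: localization_in_def)
  show "\<one> \<in> localization_in R S A" using localization_in_supset[OF A S(2)] A'(3) by auto
  show "\<ominus> h \<in> localization_in R S A" if "h \<in> localization_in R S A" for h
  proof -
    obtain a s where h: "h = a \<otimes> inv s" "a \<in> A" "s \<in> S"
      using \<open>h \<in> _\<close> unfolding localization_in_def by blast
    then have "\<ominus> h = (\<ominus> a) \<otimes> inv s" using car[of a s] inv_nonzero[of s] by (simp add: l_minus)
    then show ?thesis using h A'(5) unfolding localization_in_def by blast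
  qed
  show "h \<otimes> k \<in> localization_in R S A"
    if hk: "h \<in> localization_in R S A" "k \<in> localization_in R S A" for h k
  proof -
    obtain a s b t where h: "h = a \<otimes> inv s" "a \<in> A" "s \<in> S" "k = b \<otimes> inv t" "b \<in> A" "t \<in> S"
      using hk unfolding localization_in_def by blast
    then have "h \<otimes> k = (a \<otimes> b) \<otimes> inv (s \<otimes> t)" using car frac_mult by simp
    then show ?thesis using h A'(6) S_mult unfolding localization_in_def by blast
  qed
  show "h \<oplus> k \<in> localization_in R S A"
    if hk: "h \<in> localization_in R S A" "k \<in> localization_in R S A" for h k
  proof -
    obtain a s b t where h: "h = a \<otimes> inv s" "a \<in> A" "s \<in> S" "k = b \<otimes> inv t" "b \<in> A" "t \<in> S"
      using hk unfolding localization_in_def by blast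
    then have "h \<oplus> k = (a \<otimes> t \<oplus> b \<otimes> s) \<otimes> inv (s \<otimes> t)" using car frac_add by simp
    \<comment> \<open>Denominators come from \<open>A\<close> as well, so cross multiplication does
      not leave \<open>A\<close>.\<close>
    moreover have "a \<otimes> t \<oplus> b \<otimes> s \<in> A" using h S(1) by (intro A'(6,7)) auto
    ultimately show ?thesis using h S_mult unfolding localization_in_def by blast
  qed
qed

text \<open>Old fractions remain fractions over the larger set, and new ones stay in the field. This
  transfers the hypothesis on \<open>R\<close> to its localization.\<close>

lemma is_fraction_field_of_mono:
  assumes "is_fraction_field_of R A" "A \<subseteq> B" "B \<subseteq> carrier R"
  shows "is_fraction_field_of R B"
proof -
  have "carrier R \<subseteq> {r \<otimes> inv s | r s. r \<in> B \<and> s \<in> B - {\<zero>}}"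
    using assms(1,2) unfolding is_fraction_field_of_def by auto
  then show ?thesis
    using frac_closed subsetD[OF assms(3)] unfolding is_fraction_field_of_def by blast
qed

text \<open>The localization contains \<open>F\<close>, hence with every \<open>s\<close> also the field \<open>F(s)\<close>, which
  contains \<open>s\<^sup>-\<^sup>1\<close> because \<open>s\<close> is algebraic.\<close>

lemma localization_in_eq_carrier:
  assumes F: "subfield F R" "finite_dimension F (carrier R)"
    and A: "subring A R" "is_fraction_field_of R A" and D: "subring D R" "D \<subseteq> A"
    and FD: "\<And>f. f \<in> F \<Longrightarrow> f \<in> D \<or> inv f \<in> D"
  shows "localization_in R (D - {\<zero>}) A = carrier R"
proof
  define M where "M = localization_in R (D - {\<zero>}) A"
  note A' = subringE[OF A(1)] and D' = subringE[OF D(1)]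
  have M: "subring M R"
    unfolding M_def
  proof (rule subring_localization_in[OF A(1)])
    show "s \<otimes> t \<in> D - {\<zero>}" if "s \<in> D - {\<zero>}" "t \<in> D - {\<zero>}" for s t
      using that D'(1,6) integral[of s t] by auto
  qed (use D D' in auto)
  have AM: "A \<subseteq> M" unfolding M_def using D' by (intro localization_in_supset[OF A(1)]) auto
  have FM: "F \<subseteq> M"
  proof
    fix f assume f: "f \<in> F"
    show "f \<in> M"
    proof (cases "f \<in> D")
      case True then show ?thesis using AM D by auto
    next
      case False
      \<comment> \<open>The inverse of \<open>f\<close> is itself an admissible denominator, which
        exhibits \<open>f\<close> as the fraction
        \<open>\<one> \<otimes> inv (inv f)\<close>.\<close>
      then have fD: "inv f \<in> D" and "f \<noteq> \<zero>" using FD f D'(2) by auto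
      then have "f \<in> carrier R - {\<zero>}" using f subfieldE(3)[OF F(1)] by auto
      then have "f = \<one> \<otimes> inv (inv f)" "inv f \<noteq> \<zero>"
        using inv_nonzero field_Units Units_inv_inv by auto
      then show ?thesis unfolding M_def localization_in_def using fD A'(3) by blast
    qed
  qed
  show "carrier R \<subseteq> localization_in R (D - {\<zero>}) A"
  proof
    fix z assume "z \<in> carrier R"
    then obtain r s where z: "z = r \<otimes> inv s" "r \<in> A" "s \<in> A - {\<zero>}"
      using A(2) unfolding is_fraction_field_of_def by blast
    then have s: "s \<in> carrier R" "s \<in> M" using A'(1) AM by auto
    have "(algebraic over F) s"
      using finite_dimension_imp_algebraic[OF F(1) carrier_is_subring F(2)] s by simp
    then have K: "subfield (simple_extension F s) R"
      using simple_extension_is_subfield F(1) s by blast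
    have "s \<in> simple_extension F s - {\<zero>}"
      using simple_extension_mem[OF subfieldE(1)[OF F(1)]] s z by simp
    then have "inv s \<in> simple_extension F s" using subfield_m_inv(1)[OF K] by blast
    then have "inv s \<in> M" using simple_extension_subring_incl[OF M FM s(2)] by blast
    then show "z \<in> localization_in R (D - {\<zero>}) A"
      using z AM subringE(6)[OF M] unfolding M_def by blast
  qed
  show "localization_in R (D - {\<zero>}) A \<subseteq> carrier R" using subringE(1)[OF M] unfolding M_def .
qed

end

section \<open>Subfields with a valuation\<close>

text \<open>The valued field is a subset of \<open>E\<close>, so multiplication and inverses are
  always those of \<open>E\<close>. The locale serves two valuations on the same \<open>F\<close>:
  the given one and its coarsening.\<close>

locale valued_subfield = field E + G: ord_ab_group G
  for E :: "('a, 'c) ring_scheme" (structure) and G :: "('g, 'b) ord_monoid_scheme" +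
  fixes F :: "'a set" and v :: "'a \<Rightarrow> 'g with_infty"
  assumes subfield: "subfield F E"
    and valuation: "valuation (E\<lparr>carrier := F\<rparr>) G v"
begin

abbreviation "val x \<equiv> the_fin (v x)"

abbreviation "O\<^sub>v \<equiv> valuation_ring (E\<lparr>carrier := F\<rparr>) G v"

lemma F_carrier: "x \<in> F - {\<zero>} \<Longrightarrow> x \<in> carrier E - {\<zero>}"
  using subfieldE(3)[OF subfield] by auto

lemma F_mult: "\<lbrakk>x \<in> F - {\<zero>}; y \<in> F - {\<zero>}\<rbrakk> \<Longrightarrow> x \<otimes> y \<in> F - {\<zero>}"
  using subringE(6)[OF subfieldE(1)[OF subfield]] F_carrier integral[of x y] by auto

lemma F_inv: "x \<in> F - {\<zero>} \<Longrightarrow> inv x \<in> F - {\<zero>}"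
  using subfield_m_inv(1)[OF subfield] .

lemma F_one: "\<one> \<in> F - {\<zero>}"
  using subringE(3)[OF subfieldE(1)[OF subfield]] by auto

lemma F_r_inv: "x \<in> F - {\<zero>} \<Longrightarrow> x \<otimes> inv x = \<one>"
  using subfield_m_inv(2)[OF subfield] .

lemma v_zero: "v \<zero> = Infty"
  using valuation.val_infty[OF valuation] subringE(2)[OF subfieldE(1)[OF subfield]] by simp

lemma v_eq_Fin: assumes "x \<in> F - {\<zero>}" shows "v x = Fin (val x)"
  using valuation.val_infty[OF valuation, of x] assms by (cases "v x") auto

lemma val_closed: assumes "x \<in> F - {\<zero>}" shows "val x \<in> carrier G"
proof -
  have "v x \<in> with_infty_set (carrier G)"
    using valuation.val_image[OF valuation] assms by auto
  then show ?thesis using v_eq_Fin[OF assms] unfolding with_infty_set_def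
    by (metis imageE insertE with_infty.distinct(1) with_infty.inject)
qed

lemma val_surj: assumes "g \<in> carrier G" obtains x where "x \<in> F - {\<zero>}" "val x = g"
proof -
  have "Fin g \<in> v ` F"
    using valuation.val_image[OF valuation] assms by (auto simp: with_infty_set_def)
  then obtain x where "x \<in> F" "v x = Fin g" by auto
  then show ?thesis using that[of x] v_zero by (metis Diff_iff singletonD with_infty.distinct(1) with_infty.sel)
qed

lemma val_mult:
  assumes "x \<in> F - {\<zero>}" "y \<in> F - {\<zero>}"
  shows "val (x \<otimes> y) = val x \<otimes>\<^bsub>G\<^esub> val y"
proof -
  have "v (x \<otimes> y) = infty_add G (Fin (val x)) (Fin (val y))"
    using valuation.val_mult[OF valuation, of x y] v_eq_Fin assms by simp
  then show ?thesis by simp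
qed

lemma val_one: "val \<one> = \<one>\<^bsub>G\<^esub>"
  using val_mult[of \<one> \<one>] F_one val_closed[of \<one>] by simp

lemma val_inv: assumes "x \<in> F - {\<zero>}" shows "val (inv x) = inv\<^bsub>G\<^esub> val x"
  using val_mult[OF assms F_inv[OF assms]] F_r_inv[OF assms] val_one val_closed F_inv assms
  by (metis G.comm_inv_char)

text \<open>Zero is listed apart because \<open>val \<zero>\<close> is \<open>the_fin Infty\<close>,
  an unspecified element.\<close>

lemma valuation_ring_iff:
  "x \<in> O\<^sub>v \<longleftrightarrow> x = \<zero> \<or> x \<in> F - {\<zero>} \<and> \<one>\<^bsub>G\<^esub> \<preceq>\<^bsub>G\<^esub> val x"
  unfolding valuation_ring_def
proof (cases "x \<in> F - {\<zero>}")
  case True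
  obtain g where "v x = Fin g" using v_eq_Fin[OF True] by blast
  then show "x \<in> {x \<in> carrier (E\<lparr>carrier := F\<rparr>). infty_le G (Fin \<one>\<^bsub>G\<^esub>) (v x)} \<longleftrightarrow>
      x = \<zero> \<or> x \<in> F - {\<zero>} \<and> \<one>\<^bsub>G\<^esub> \<preceq>\<^bsub>G\<^esub> val x"
    using True by simp
next
  case False
  then show "x \<in> {x \<in> carrier (E\<lparr>carrier := F\<rparr>). infty_le G (Fin \<one>\<^bsub>G\<^esub>) (v x)} \<longleftrightarrow>
      x = \<zero> \<or> x \<in> F - {\<zero>} \<and> \<one>\<^bsub>G\<^esub> \<preceq>\<^bsub>G\<^esub> val x"
    using v_zero subringE(2)[OF subfieldE(1)[OF subfield]] by auto
qed

lemma zero_in_valuation_ring: "\<zero> \<in> O\<^sub>v"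
  by (simp add: valuation_ring_iff)

lemma one_in_valuation_ring: "\<one> \<in> O\<^sub>v"
  using F_one val_one G.ord_refl by (auto simp: valuation_ring_iff)

lemma valuation_ring_subset: "O\<^sub>v \<subseteq> F"
  by (auto simp: valuation_ring_def)

lemma valuation_ring_or_inv:
  assumes "f \<in> F" shows "f \<in> O\<^sub>v \<or> inv f \<in> O\<^sub>v"
proof (cases "f = \<zero>")
  case False
  then have f: "f \<in> F - {\<zero>}" using assms by simp
  then have "\<one>\<^bsub>G\<^esub> \<preceq>\<^bsub>G\<^esub> val f \<or> \<one>\<^bsub>G\<^esub> \<preceq>\<^bsub>G\<^esub> val (inv f)"
    using G.ord_total[of "\<one>\<^bsub>G\<^esub>" "val f"] val_closed G.ord_inv_one_iff(2) by (simp add: val_inv)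
  then show ?thesis using f F_inv valuation_ring_iff by blast
qed (simp add: zero_in_valuation_ring)

section \<open>Cuts generated by the values of divisors\<close>

text \<open>The divisors \<open>f\<close> range over all nonzero elements of \<open>F\<close>, not
  only over a valuation ring. Hence the set makes sense for every \<open>z\<close> and refers to no
  denominator.\<close>

definition divisor_values :: "'a set \<Rightarrow> 'a \<Rightarrow> 'g set" where
  "divisor_values A z = (\<lambda>f. val f) ` {f \<in> F - {\<zero>}. \<exists>a\<in>A. z = f \<otimes> a}"

lemma divisor_values_closed: "divisor_values A z \<subseteq> carrier G"
  using val_closed by (auto simp: divisor_values_def)

text \<open>A zero \<open>a\<close> would force \<open>x = \<zero>\<close>. So \<open>val\<close> is
  only ever applied where the valuation is finite.\<close>

lemma support_set_subset:
  assumes "D \<subseteq> F" "A \<subseteq> carrier E" "x \<noteq> \<zero>"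
  shows "support_set E A D x \<subseteq> F - {\<zero>}"
  using assms by (auto simp: support_set_def l_coset_def)

text \<open>\<open>D\<close> is not assumed to be the valuation ring of \<open>v\<close>: the lemma is also needed for a
  coarsening of the valuation that has \<open>D\<close> as its ring.\<close>

lemma cut_plus_support_set:
  assumes A: "subring A E" and D: "D \<subseteq> A \<inter> F" "\<one> \<in> D"
    and D_val: "\<And>f. f \<in> F - {\<zero>} \<Longrightarrow> f \<in> D \<or> val f \<preceq>\<^bsub>G\<^esub> \<one>\<^bsub>G\<^esub>"
    and x: "x \<in> A - {\<zero>}" and y: "y \<in> D - {\<zero>}"
  shows "cut_plus G ((\<lambda>a. val a) ` support_set E A D x)
      \<otimes>\<^bsub>cut_monoid G\<^esub> cut_embed G (inv\<^bsub>G\<^esub> (val y))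
    = cut_plus G (divisor_values A (x \<otimes> inv y))"
proof -
  note A' = subringE[OF A]
  let ?T = "(\<lambda>a. val a) ` support_set E A D x"
  have yF: "y \<in> F - {\<zero>}" using y D by auto
  have xE: "x \<in> carrier E" using x A' by auto
  have supp: "support_set E A D x \<subseteq> F - {\<zero>}"
    using support_set_subset[of D A x] D A' x by auto
  then have T: "?T \<subseteq> carrier G" using val_closed by blast
  have c: "inv\<^bsub>G\<^esub> (val y) \<in> carrier G" using yF val_closed by simp
  have "cut_plus G ((\<lambda>t. t \<otimes>\<^bsub>G\<^esub> inv\<^bsub>G\<^esub> (val y)) ` ?T) = cut_plus G (divisor_values A (x \<otimes> inv y))"
  proof (rule G.cut_plus_cofinal)
    show "(\<lambda>t. t \<otimes>\<^bsub>G\<^esub> inv\<^bsub>G\<^esub> (val y)) ` ?T \<subseteq> carrier G" using T c by auto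
    show "divisor_values A (x \<otimes> inv y) \<subseteq> carrier G" by (rule divisor_values_closed)
  next
    \<comment> \<open>In this direction there is even an inclusion: a divisor \<open>a\<close> of
      \<open>x\<close> gives the divisor \<open>a \<otimes> inv y\<close> of the fraction, whose
      value is exactly \<open>t\<close>.\<close>
    fix t assume "t \<in> (\<lambda>t. t \<otimes>\<^bsub>G\<^esub> inv\<^bsub>G\<^esub> (val y)) ` ?T"
    then obtain a where a: "a \<in> support_set E A D x" and t: "t = val a \<otimes>\<^bsub>G\<^esub> inv\<^bsub>G\<^esub> (val y)"
      by auto
    have aF: "a \<in> F - {\<zero>}" using a supp by auto
    obtain r where r: "r \<in> A" "x = a \<otimes> r" using a by (auto simp: support_set_def l_coset_def)
    have "r \<in> carrier E" "a \<in> carrier E" "inv y \<in> carrier E"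
      using r A' F_carrier[OF aF] F_carrier[OF F_inv[OF yF]] by auto
    then have "x \<otimes> inv y = (a \<otimes> inv y) \<otimes> r" using r by (simp add: m_ac)
    moreover have "a \<otimes> inv y \<in> F - {\<zero>}" using F_mult F_inv aF yF by blast
    ultimately have "val (a \<otimes> inv y) \<in> divisor_values A (x \<otimes> inv y)"
      using r(1) unfolding divisor_values_def by blast
    moreover have "val (a \<otimes> inv y) = t" using t val_mult[OF aF F_inv[OF yF]] val_inv[OF yF] by simp
    moreover have "t \<in> carrier G" using t val_closed aF c by simp
    ultimately show "\<exists>u\<in>divisor_values A (x \<otimes> inv y). t \<preceq>\<^bsub>G\<^esub> u" using G.ord_refl by metis
  next
    fix u assume "u \<in> divisor_values A (x \<otimes> inv y)"
    then obtain f r where f: "f \<in> F - {\<zero>}" "r \<in> A" "x \<otimes> inv y = f \<otimes> r" "u = val f"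
      unfolding divisor_values_def by blast
    have E: "f \<in> carrier E" "r \<in> carrier E" "y \<in> carrier E - {\<zero>}"
      using f A' F_carrier[OF f(1)] F_carrier[OF yF] by auto
    have "x = f \<otimes> r \<otimes> y" using frac_eq_iff[of x y "f \<otimes> r"] f(3) E xE by simp
    then have xfy: "x = (f \<otimes> y) \<otimes> r" using E by (simp add: m_ac)
    have fy: "f \<otimes> y \<in> F - {\<zero>}" using F_mult f(1) yF by blast
    have u: "u \<in> carrier G" using f val_closed by simp
    \<comment> \<open>In this direction only cofinality is obtained: \<open>f \<otimes> y\<close>
      divides \<open>x\<close> in \<open>A\<close> but may lie outside \<open>D\<close>, and then
      \<open>\<one>\<close> takes its place.\<close>
    have "\<exists>a\<in>support_set E A D x. val (f \<otimes> y) \<preceq>\<^bsub>G\<^esub> val a"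
    proof (cases "f \<otimes> y \<in> D")
      case True
      then have "f \<otimes> y \<in> support_set E A D x"
        using xfy f(2) unfolding support_set_def l_coset_def by blast
      then show ?thesis using G.ord_refl val_closed[OF fy] by blast
    next
      case False
      then have "val (f \<otimes> y) \<preceq>\<^bsub>G\<^esub> val \<one>" using D_val fy val_one by auto
      moreover have "x \<in> \<one> <# A" unfolding l_coset_def using x xE by force
      then have "\<one> \<in> support_set E A D x" using D unfolding support_set_def by auto
      ultimately show ?thesis by blast
    qed
    then obtain a where a: "a \<in> support_set E A D x" "val (f \<otimes> y) \<preceq>\<^bsub>G\<^esub> val a" by blast
    have "u \<preceq>\<^bsub>G\<^esub> val a \<otimes>\<^bsub>G\<^esub> inv\<^bsub>G\<^esub> (val y)"
      using a f(4) val_mult[OF f(1) yF] u val_closed[OF yF] val_closed[of a] supp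
      by (subst G.ord_mult_inv_iff) auto
    then show "\<exists>t\<in>(\<lambda>t. t \<otimes>\<^bsub>G\<^esub> inv\<^bsub>G\<^esub> (val y)) ` ?T. u \<preceq>\<^bsub>G\<^esub> t" using a(1) by blast
  qed
  then show ?thesis using G.cut_plus_translate[OF T c] by simp
qed

text \<open>The denominator of the cofactor is moved over to the divisor, \<open>f \<otimes> (r
  \<otimes> inv s) = (f \<otimes> inv s) \<otimes> r\<close>, at no change of value. Hence the sets
  themselves agree, not only their cuts.\<close>

lemma divisor_values_localization_in:
  assumes A: "subring A E" and S: "S \<subseteq> A \<inter> F - {\<zero>}" "\<one> \<in> S"
    and S_val: "\<And>s. s \<in> S \<Longrightarrow> val s = \<one>\<^bsub>G\<^esub>"
  shows "divisor_values (localization_in E S A) z = divisor_values A z"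
proof
  show "divisor_values A z \<subseteq> divisor_values (localization_in E S A) z"
    using localization_in_supset[OF A S(2)] unfolding divisor_values_def by blast
  show "divisor_values (localization_in E S A) z \<subseteq> divisor_values A z"
  proof
    fix g assume "g \<in> divisor_values (localization_in E S A) z"
    then obtain f r s where f: "f \<in> F - {\<zero>}" "r \<in> A" "s \<in> S" "z = f \<otimes> (r \<otimes> inv s)" "g = val f"
      unfolding divisor_values_def localization_in_def by blast
    have s: "s \<in> F - {\<zero>}" using f(3) S by auto
    have fs: "f \<otimes> inv s \<in> F - {\<zero>}" using F_mult F_inv f(1) s by blast
    have "f \<in> carrier E" "r \<in> carrier E" "inv s \<in> carrier E"
      using f subringE(1)[OF A] F_carrier[OF f(1)] F_carrier[OF F_inv[OF s]] by auto
    then have "z = (f \<otimes> inv s) \<otimes> r" using f(4) by (simp add: m_ac)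
    moreover have "val (f \<otimes> inv s) = g"
      using val_mult[OF f(1) F_inv[OF s]] val_inv[OF s] S_val[OF f(3)] f(5) val_closed[OF f(1)] by simp
    ultimately show "g \<in> divisor_values A z" using fs f(2) unfolding divisor_values_def by blast
  qed
qed

section \<open>The isolated subgroup of a prime ideal\<close>

lemma primeideal_mult:
  assumes "primeideal P (E\<lparr>carrier := O\<^sub>v\<rparr>)" "p \<in> P" "x \<in> O\<^sub>v"
  shows "p \<otimes> x \<in> P"
  using ideal.I_r_closed[OF primeideal.axioms(1)[OF assms(1)], of p x] assms by simp

lemma primeideal_props:
  assumes "primeideal P (E\<lparr>carrier := O\<^sub>v\<rparr>)"
  shows "P \<subseteq> O\<^sub>v" "\<zero> \<in> P" "\<one> \<notin> P"
proof -
  interpret P: primeideal P "E\<lparr>carrier := O\<^sub>v\<rparr>" by fact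
  show "P \<subseteq> O\<^sub>v" using P.a_subset by simp
  show "\<zero> \<in> P" using additive_subgroup.zero_closed[OF P.additive_subgroup_axioms] by simp
  show "\<one> \<notin> P" using P.I_notcarr P.one_imp_carrier by auto
qed

text \<open>The quotient of \<open>s\<close> by \<open>p\<close> has nonnegative value, so
  \<open>s\<close> is a multiple of \<open>p\<close> within the valuation ring. Thus membership in
  \<open>P\<close> is upward closed in the value.\<close>

lemma val_le_imp_in_primeideal:
  assumes P: "primeideal P (E\<lparr>carrier := O\<^sub>v\<rparr>)" and p: "p \<in> P - {\<zero>}"
    and s: "s \<in> F - {\<zero>}" and le: "val p \<preceq>\<^bsub>G\<^esub> val s"
  shows "s \<in> P"
proof -
  have pF: "p \<in> F - {\<zero>}" using p primeideal_props(1)[OF P] valuation_ring_subset by auto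
  have "inv p \<otimes> s \<in> F - {\<zero>}" using F_mult F_inv pF s by blast
  moreover have "\<one>\<^bsub>G\<^esub> \<preceq>\<^bsub>G\<^esub> val s \<otimes>\<^bsub>G\<^esub> inv\<^bsub>G\<^esub> (val p)"
    using le pF s val_closed by (subst G.ord_mult_inv_iff) auto
  then have "\<one>\<^bsub>G\<^esub> \<preceq>\<^bsub>G\<^esub> val (inv p \<otimes> s)"
    using val_mult[OF F_inv[OF pF] s] val_inv[OF pF] pF s val_closed by (simp add: G.m_comm)
  ultimately have "inv p \<otimes> s \<in> O\<^sub>v" using valuation_ring_iff by blast
  then have "p \<otimes> (inv p \<otimes> s) \<in> P" using primeideal_mult P p by blast
  moreover have "p \<otimes> (inv p \<otimes> s) = s"
    using F_carrier[OF pF] F_carrier[OF s] F_carrier[OF F_inv[OF pF]] F_r_inv[OF pF]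
    by (simp add: m_assoc[symmetric])
  ultimately show ?thesis by simp
qed

text \<open>Upward closure rules out that \<open>s \<notin> P\<close> shares its value with a member
  of \<open>P\<close>. If \<open>val s\<close> were the inverse of \<open>val p\<close>, then
  \<open>val p \<preceq> \<one>\<close> and \<open>\<one>\<close> would belong to
  \<open>P\<close>.\<close>

lemma val_in_prime_isolated_subgroup_iff:
  assumes P: "primeideal P (E\<lparr>carrier := O\<^sub>v\<rparr>)" and s: "s \<in> O\<^sub>v - {\<zero>}"
  shows "val s \<in> prime_isolated_subgroup G v P \<longleftrightarrow> s \<notin> P"
proof
  have sF: "s \<in> F - {\<zero>}" using s valuation_ring_subset by auto
  show "s \<notin> P" if "val s \<in> prime_isolated_subgroup G v P"
    using that v_eq_Fin[OF sF] unfolding prime_isolated_subgroup_def by auto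
  show "val s \<in> prime_isolated_subgroup G v P" if sP: "s \<notin> P"
    unfolding prime_isolated_subgroup_def
  proof (intro CollectI conjI ballI allI impI)
    show "val s \<in> carrier G" using val_closed[OF sF] .
    fix p \<gamma> assume p: "p \<in> P" "v p = Fin \<gamma>"
    then have p0: "p \<in> P - {\<zero>}" using v_zero by auto
    then have pO: "p \<in> O\<^sub>v - {\<zero>}" using primeideal_props(1)[OF P] by auto
    then have pF: "p \<in> F - {\<zero>}" using valuation_ring_subset by auto
    have gam: "val p = \<gamma>" using p(2) by simp
    show "val s \<noteq> \<gamma>"
      using val_le_imp_in_primeideal[OF P p0 sF] sP gam G.ord_refl[OF val_closed[OF sF]] by auto
    show "val s \<noteq> inv\<^bsub>G\<^esub> \<gamma>"
    proof
      assume "val s = inv\<^bsub>G\<^esub> \<gamma>"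
      then have "\<one>\<^bsub>G\<^esub> \<preceq>\<^bsub>G\<^esub> inv\<^bsub>G\<^esub> (val p)" using s valuation_ring_iff gam by auto
      then have "val p \<preceq>\<^bsub>G\<^esub> val \<one>" using G.ord_inv_one_iff(2)[OF val_closed[OF pF]] val_one by simp
      then have "\<one> \<in> P" using val_le_imp_in_primeideal[OF P p0 F_one] by simp
      then show False using primeideal_props(3)[OF P] by simp
    qed
  qed
qed

text \<open>Every nonnegative group element is the value of some element of the valuation ring, and
  there \<open>H\<close> corresponds to the complement of \<open>P\<close>. Primality then gives
  closure, and upward closure of \<open>P\<close> gives isolatedness.\<close>

lemma isolated_subgroup_prime:
  assumes P: "primeideal P (E\<lparr>carrier := O\<^sub>v\<rparr>)"
  shows "isolated_subgroup (prime_isolated_subgroup G v P) G"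
proof -
  define H where "H = prime_isolated_subgroup G v P"
  interpret P: primeideal P "E\<lparr>carrier := O\<^sub>v\<rparr>" by fact
  have iff: "val s \<in> H \<longleftrightarrow> s \<notin> P" if "s \<in> O\<^sub>v - {\<zero>}" for s
    using val_in_prime_isolated_subgroup_iff[OF P that] unfolding H_def .
  have lift: "\<exists>s\<in>O\<^sub>v - {\<zero>}. val s = a" if a: "a \<in> carrier G" "\<one>\<^bsub>G\<^esub> \<preceq>\<^bsub>G\<^esub> a" for a
  proof -
    obtain s where s: "s \<in> F - {\<zero>}" "val s = a" by (rule val_surj[OF a(1)])
    then have "s \<in> O\<^sub>v" using a(2) valuation_ring_iff by simp
    then show ?thesis using s by blast
  qed
  have sub: "H \<subseteq> carrier G" unfolding H_def prime_isolated_subgroup_def by auto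
  have "isolated_subgroup H G"
  proof (rule G.isolated_subgroupI[OF sub])
    show "\<one>\<^bsub>G\<^esub> \<in> H"
      using iff[of \<one>] primeideal_props(3)[OF P] one_in_valuation_ring val_one by auto
    show "inv\<^bsub>G\<^esub> a \<in> H" if "a \<in> H" for a
    proof -
      have ac: "a \<in> carrier G" using that sub by auto
      \<comment> \<open>The defining condition is symmetric under inversion, but cancelling
        \<open>inv\<close> on both sides needs \<open>\<gamma>\<close> in the carrier.\<close>
      have "\<gamma> \<in> carrier G" if "p \<in> P" "v p = Fin \<gamma>" for p \<gamma>
      proof -
        have "p \<in> F - {\<zero>}" using that primeideal_props(1)[OF P] valuation_ring_subset v_zero by auto
        then show ?thesis using val_closed that(2) by fastforce
      qed
      then show ?thesis using that ac unfolding H_def prime_isolated_subgroup_def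
        by (auto dest: G.inv_eq_imp_eq)
    qed
    show "a \<otimes>\<^bsub>G\<^esub> b \<in> H"
      if ab: "a \<in> H" "b \<in> H" "\<one>\<^bsub>G\<^esub> \<preceq>\<^bsub>G\<^esub> a" "\<one>\<^bsub>G\<^esub> \<preceq>\<^bsub>G\<^esub> b" for a b
    proof -
      obtain s t where st: "s \<in> O\<^sub>v - {\<zero>}" "val s = a" "t \<in> O\<^sub>v - {\<zero>}" "val t = b"
        using lift ab sub by (meson subsetD)
      then have F: "s \<in> F - {\<zero>}" "t \<in> F - {\<zero>}" using valuation_ring_subset by auto
      have "s \<otimes> t \<notin> P" using P.I_prime[of s t] st ab iff by auto
      moreover have "s \<otimes> t \<in> O\<^sub>v" using P.m_closed[of s t] st by simp
      ultimately show ?thesis using iff[of "s \<otimes> t"] F_mult[OF F] val_mult[OF F] st by auto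
    qed
    show "g \<in> H" if gh: "g \<in> carrier G" "h \<in> H" "\<one>\<^bsub>G\<^esub> \<preceq>\<^bsub>G\<^esub> g" "g \<preceq>\<^bsub>G\<^esub> h" for g h
    proof -
      have h: "h \<in> carrier G" "\<one>\<^bsub>G\<^esub> \<preceq>\<^bsub>G\<^esub> h" using gh sub G.ord_trans[of "\<one>\<^bsub>G\<^esub>" g h] by auto
      obtain s where s: "s \<in> O\<^sub>v - {\<zero>}" "val s = g" using lift gh by blast
      obtain t where t: "t \<in> O\<^sub>v - {\<zero>}" "val t = h" using lift h by blast
      have "t \<in> F - {\<zero>}" using t valuation_ring_subset by auto
      then have "s \<notin> P" using val_le_imp_in_primeideal[OF P, of s t] iff[OF t(1)] s t gh by auto
      then show ?thesis using iff s by auto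
    qed
  qed
  then show ?thesis unfolding H_def .
qed

end

section \<open>The reduced filter map as a filter quasi-valuation\<close>

text \<open>The formula for \<open>w\<close> constrains all representing fractions at once, so
  unique existence is what expresses that \<open>w\<close> is well defined. The last conjunct then
  speaks about this one map.\<close>

theorem theorem10p11:
  fixes E :: "('a, 'c) ring_scheme"
    and F R P S O\<^sub>v :: "'a set" and H :: "'g set"
    and \<Gamma>\<^sub>v :: "('g, 'b) ord_monoid_scheme"
    and \<Gamma>\<^sub>u :: "'g set ord_monoid"
    and v :: "'a \<Rightarrow> 'g with_infty"
    and u :: "'a \<Rightarrow> 'g set with_infty"
  assumes "field E" and "subfield F E"
    and "ring.finite_dimension E F (carrier E)"
    and "valuation (E\<lparr>carrier := F\<rparr>) \<Gamma>\<^sub>v v"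
    and "O\<^sub>v = valuation_ring (E\<lparr>carrier := F\<rparr>) \<Gamma>\<^sub>v v"
    and "subring R E" and "is_fraction_field_of E R" and "R \<inter> F = O\<^sub>v"
    and "primeideal P (E\<lparr>carrier := O\<^sub>v\<rparr>)"
    and "H = prime_isolated_subgroup \<Gamma>\<^sub>v v P"
    and "S = O\<^sub>v - P"
    and "\<Gamma>\<^sub>u = ord_quotient \<Gamma>\<^sub>v H"
    and "u = coarsened_valuation \<Gamma>\<^sub>v H v"
  shows "valuation (E\<lparr>carrier := F\<rparr>) \<Gamma>\<^sub>u u \<and>
         valuation_ring (E\<lparr>carrier := F\<rparr>) \<Gamma>\<^sub>u u = localization_in E S O\<^sub>v \<and>
         (\<exists>!w. is_reduced_filter_map E F R \<Gamma>\<^sub>v v H w) \<and>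
         (\<forall>w. is_reduced_filter_map E F R \<Gamma>\<^sub>v v H w \<longrightarrow>
            is_filter_quasi_valuation E F (localization_in E S R) \<Gamma>\<^sub>u u w)"
proof -
  interpret E: field E by fact
  interpret G: ord_ab_group \<Gamma>\<^sub>v using assms(4) by (rule valuation.axioms(2))
  interpret V: valued_subfield E \<Gamma>\<^sub>v F v
    by (intro valued_subfield.intro valued_subfield_axioms.intro assms E.field_axioms G.ord_ab_group_axioms)
  note P = assms(9)[unfolded assms(5)]
  interpret H: isolated_subgroup H \<Gamma>\<^sub>v
    unfolding assms(10) by (rule V.isolated_subgroup_prime[OF P])
  have u: "valuation (E\<lparr>carrier := F\<rparr>) \<Gamma>\<^sub>u u"
    unfolding assms(12,13) by (rule H.valuation_coarsened[OF assms(4)])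
  interpret Gu: ord_ab_group \<Gamma>\<^sub>u using u by (rule valuation.axioms(2))
  interpret U: valued_subfield E \<Gamma>\<^sub>u F u
    by (intro valued_subfield.intro valued_subfield_axioms.intro assms u E.field_axioms Gu.ord_ab_group_axioms)
  note R = subringE[OF assms(6)] and F = subringE[OF subfieldE(1)[OF assms(2)]]
  define R' where "R' = localization_in E S R"

  have uval: "U.val f = H #>\<^bsub>\<Gamma>\<^sub>v\<^esub> V.val f" if f: "f \<in> F - {\<zero>\<^bsub>E\<^esub>}" for f
  proof -
    obtain g where "v f = Fin g" using V.v_eq_Fin[OF f] by blast
    then show ?thesis unfolding assms(13) coarsened_valuation_def by simp
  qed
  have one_u: "\<one>\<^bsub>\<Gamma>\<^sub>u\<^esub> = H" unfolding assms(12) by (simp add: H.ord_quotient_simps)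
  have Hone: "H #>\<^bsub>\<Gamma>\<^sub>v\<^esub> \<one>\<^bsub>\<Gamma>\<^sub>v\<^esub> = H" using G.coset_mult_one[OF H.subset] .
  have Ov: "O\<^sub>v \<subseteq> R" "O\<^sub>v \<subseteq> F" "\<one>\<^bsub>E\<^esub> \<in> O\<^sub>v" "\<zero>\<^bsub>E\<^esub> \<in> O\<^sub>v"
    using assms(8) R(2,3) F(2,3) by auto
  have Ov_mult: "a \<otimes>\<^bsub>E\<^esub> b \<in> O\<^sub>v" if "a \<in> O\<^sub>v" "b \<in> O\<^sub>v" for a b
    using that R(6) F(6) unfolding assms(8)[symmetric] by auto
  have subring_Ov: "subring O\<^sub>v E"
    using R F unfolding assms(8)[symmetric] by (intro E.subringI) auto
  have S: "S \<subseteq> O\<^sub>v - {\<zero>\<^bsub>E\<^esub>}" "\<one>\<^bsub>E\<^esub> \<in> S"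
    using V.primeideal_props[OF P] Ov unfolding assms(11) by auto
  have S_mult: "s \<otimes>\<^bsub>E\<^esub> t \<in> S" if "s \<in> S" "t \<in> S" for s t
    using primeideal.I_prime[OF P, of s t] that Ov_mult[of s t]
    unfolding assms(11) assms(5)[symmetric] by auto
  have S_F: "s \<in> F - {\<zero>\<^bsub>E\<^esub>}" if "s \<in> S" for s using that S Ov by auto
  have val_S: "V.val s \<in> H" if "s \<in> S" for s
    using V.val_in_prime_isolated_subgroup_iff[OF P, of s] that S
    unfolding assms(10,11) assms(5)[symmetric] by auto
  \<comment> \<open>Values of elements outside \<open>P\<close> fall into \<open>H\<close>, the
    neutral coset. So \<open>S\<close> consists of units of the coarser valuation ring, and
    denominators from \<open>S\<close> do not affect values.\<close>
  have uval_S: "U.val s = \<one>\<^bsub>\<Gamma>\<^sub>u\<^esub>" if "s \<in> S" for s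
    using uval[OF S_F[OF that]] val_S[OF that] one_u
      G.coset_join2[OF V.val_closed[OF S_F[OF that]] H.subgroup_axioms] by simp

  have Ou: "valuation_ring (E\<lparr>carrier := F\<rparr>) \<Gamma>\<^sub>u u = localization_in E S O\<^sub>v"
  proof (intro subset_antisym subsetI)
    fix x assume x: "x \<in> localization_in E S O\<^sub>v"
    then obtain r s where rs: "x = r \<otimes>\<^bsub>E\<^esub> inv\<^bsub>E\<^esub> s" "r \<in> O\<^sub>v" "s \<in> S"
      unfolding localization_in_def by blast
    have s: "s \<in> F - {\<zero>\<^bsub>E\<^esub>}" "inv\<^bsub>E\<^esub> s \<in> F - {\<zero>\<^bsub>E\<^esub>}" using S_F[OF rs(3)] V.F_inv by auto
    show "x \<in> valuation_ring (E\<lparr>carrier := F\<rparr>) \<Gamma>\<^sub>u u"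
    proof (cases "r = \<zero>\<^bsub>E\<^esub>")
      case True
      then have "x = \<zero>\<^bsub>E\<^esub>" using rs(1) V.F_carrier[OF s(2)] by simp
      then show ?thesis by (simp add: U.zero_in_valuation_ring)
    next
      case False
      then have r: "r \<in> F - {\<zero>\<^bsub>E\<^esub>}" using rs Ov by auto
      have "U.val x = U.val r"
        using U.val_mult[OF r s(2)] U.val_inv[OF s(1)] uval_S[OF rs(3)] U.val_closed[OF r] rs(1) by simp
      also have "\<dots> = H #>\<^bsub>\<Gamma>\<^sub>v\<^esub> V.val r" using uval[OF r] .
      finally have "\<one>\<^bsub>\<Gamma>\<^sub>u\<^esub> \<preceq>\<^bsub>\<Gamma>\<^sub>u\<^esub> U.val x"
        using H.ord_quotient_le_imp[of "\<one>\<^bsub>\<Gamma>\<^sub>v\<^esub>" "V.val r"] V.val_closed[OF r] False rs(2)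
          V.valuation_ring_iff[of r] Hone one_u unfolding assms(5,12) by simp
      moreover have "x \<in> F - {\<zero>\<^bsub>E\<^esub>}" using V.F_mult[OF r s(2)] rs(1) by simp
      ultimately show ?thesis using U.valuation_ring_iff by blast
    qed
  next
    fix x assume x: "x \<in> valuation_ring (E\<lparr>carrier := F\<rparr>) \<Gamma>\<^sub>u u"
    have loc: "y \<in> localization_in E S O\<^sub>v" if "y \<in> O\<^sub>v" for y
      using E.localization_in_supset[OF subring_Ov S(2)] that by blast
    show "x \<in> localization_in E S O\<^sub>v"
    proof (cases "x = \<zero>\<^bsub>E\<^esub>")
      case True then show ?thesis using loc Ov by simp
    next
      case False
      then have xF: "x \<in> F - {\<zero>\<^bsub>E\<^esub>}" and "\<one>\<^bsub>\<Gamma>\<^sub>u\<^esub> \<preceq>\<^bsub>\<Gamma>\<^sub>u\<^esub> U.val x"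
        using x U.valuation_ring_iff by auto
      then have "H #>\<^bsub>\<Gamma>\<^sub>v\<^esub> \<one>\<^bsub>\<Gamma>\<^sub>v\<^esub> \<preceq>\<^bsub>ord_quotient \<Gamma>\<^sub>v H\<^esub> H #>\<^bsub>\<Gamma>\<^sub>v\<^esub> V.val x"
        using uval[OF xF] one_u Hone assms(12) by simp
      then obtain h where h: "h \<in> H" "h \<preceq>\<^bsub>\<Gamma>\<^sub>v\<^esub> V.val x"
        using H.ord_quotient_le[of "\<one>\<^bsub>\<Gamma>\<^sub>v\<^esub>" "V.val x"] V.val_closed[OF xF] by auto
      show ?thesis
      proof (cases "\<one>\<^bsub>\<Gamma>\<^sub>v\<^esub> \<preceq>\<^bsub>\<Gamma>\<^sub>v\<^esub> V.val x")
        case True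
        then show ?thesis using loc xF V.valuation_ring_iff assms(5) by blast
      next
        case neg: False
        \<comment> \<open>The denominator for \<open>x\<close> is its own inverse. The bound
          \<open>h \<preceq> V.val x\<close> keeps the value of \<open>s\<close> between
          \<open>\<one>\<close> and the inverse of \<open>h\<close>, so isolatedness puts it into
          \<open>H\<close> and \<open>s\<close> avoids \<open>P\<close>.\<close>
        define s where "s = inv\<^bsub>E\<^esub> x"
        have vx: "V.val x \<in> carrier \<Gamma>\<^sub>v" using V.val_closed[OF xF] .
        have sF: "s \<in> F - {\<zero>\<^bsub>E\<^esub>}" and val_s: "V.val s = inv\<^bsub>\<Gamma>\<^sub>v\<^esub> V.val x"
          using V.F_inv[OF xF] V.val_inv[OF xF] s_def by auto
        have "\<one>\<^bsub>\<Gamma>\<^sub>v\<^esub> \<preceq>\<^bsub>\<Gamma>\<^sub>v\<^esub> V.val s"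
          using neg G.ord_total[of "\<one>\<^bsub>\<Gamma>\<^sub>v\<^esub>" "V.val x"] vx G.ord_inv_one_iff(2) val_s by simp
        moreover have "V.val s \<preceq>\<^bsub>\<Gamma>\<^sub>v\<^esub> inv\<^bsub>\<Gamma>\<^sub>v\<^esub> h"
          using G.ord_inv_iff[of "V.val x" h] h vx val_s by simp
        ultimately have "V.val s \<in> H" using H.isolated V.val_closed[OF sF] h(1) by blast
        moreover have sO: "s \<in> O\<^sub>v - {\<zero>\<^bsub>E\<^esub>}"
          using sF \<open>\<one>\<^bsub>\<Gamma>\<^sub>v\<^esub> \<preceq>\<^bsub>\<Gamma>\<^sub>v\<^esub> V.val s\<close> V.valuation_ring_iff assms(5) by blast
        ultimately have "s \<in> S"
          using V.val_in_prime_isolated_subgroup_iff[OF P, of s] assms(5,10,11) by auto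
        moreover have "x = \<one>\<^bsub>E\<^esub> \<otimes>\<^bsub>E\<^esub> inv\<^bsub>E\<^esub> s"
          unfolding s_def using V.F_carrier[OF xF] E.field_Units E.Units_inv_inv by simp
        ultimately show ?thesis using Ov(3) unfolding localization_in_def by blast
      qed
    qed
  qed

  have R': "subring R' E" unfolding R'_def
    using E.subring_localization_in[OF assms(6) _ S(2) S_mult] S Ov by blast
  have RR': "R \<subseteq> R'" unfolding R'_def by (rule E.localization_in_supset[OF assms(6) S(2)])
  have R'F: "R' \<inter> F = valuation_ring (E\<lparr>carrier := F\<rparr>) \<Gamma>\<^sub>u u"
  proof (intro subset_antisym subsetI)
    fix x assume x: "x \<in> R' \<inter> F"
    then obtain r s where rs: "x = r \<otimes>\<^bsub>E\<^esub> inv\<^bsub>E\<^esub> s" "r \<in> R" "s \<in> S"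
      unfolding R'_def localization_in_def by blast
    \<comment> \<open>Clearing the denominator puts \<open>r = x \<otimes> s\<close> into
      \<open>R \<inter> F\<close>, which is \<open>O\<^sub>v\<close>.\<close>
    have "r \<in> carrier E" "s \<in> carrier E - {\<zero>\<^bsub>E\<^esub>}" "x \<in> carrier E"
      using rs R(1) V.F_carrier[OF S_F[OF rs(3)]] x F(1) by auto
    then have "r = x \<otimes>\<^bsub>E\<^esub> s" using E.frac_eq_iff rs(1) by metis
    moreover have "x \<otimes>\<^bsub>E\<^esub> s \<in> F" using x S_F[OF rs(3)] by (intro F(6)) auto
    ultimately have "r \<in> O\<^sub>v" using rs(2) assms(8) by blast
    then show "x \<in> valuation_ring (E\<lparr>carrier := F\<rparr>) \<Gamma>\<^sub>u u"
      using rs unfolding Ou localization_in_def by blast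
  next
    fix x assume x: "x \<in> valuation_ring (E\<lparr>carrier := F\<rparr>) \<Gamma>\<^sub>u u"
    then have "x \<in> R'" using Ov(1) unfolding Ou R'_def localization_in_def by blast
    then show "x \<in> R' \<inter> F" using x U.valuation_ring_subset by blast
  qed
  \<comment> \<open>Finiteness of \<open>E\<close> over \<open>F\<close> enters here: elements of
    \<open>E\<close> need only denominators from \<open>O\<^sub>v\<close>, although the fraction
    field hypothesis allows denominators from all of \<open>R\<close>.\<close>
  have frac: "localization_in E (O\<^sub>v - {\<zero>\<^bsub>E\<^esub>}) R = carrier E"
    using V.valuation_ring_or_inv
    by (intro E.localization_in_eq_carrier[OF assms(2,3,6,7) subring_Ov Ov(1)]) (simp add: assms(5))

  have dichotomy: "f \<in> valuation_ring (E\<lparr>carrier := F\<rparr>) \<Gamma>\<^sub>u u \<or> U.val f \<preceq>\<^bsub>\<Gamma>\<^sub>u\<^esub> \<one>\<^bsub>\<Gamma>\<^sub>u\<^esub>"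
    if "f \<in> F - {\<zero>\<^bsub>E\<^esub>}" for f
    using that U.valuation_ring_iff Gu.ord_total[of "\<one>\<^bsub>\<Gamma>\<^sub>u\<^esub>" "U.val f"] U.val_closed[OF that] by auto
  \<comment> \<open>Outside \<open>O\<^sub>v\<close> the value under \<open>v\<close> is at most
    neutral, and the projection to the quotient preserves this. So the support set lemma applies to
    values of \<open>u\<close> even over \<open>O\<^sub>v\<close>, which may be smaller than the
    valuation ring of \<open>u\<close>.\<close>
  have dichotomy': "f \<in> O\<^sub>v \<or> U.val f \<preceq>\<^bsub>\<Gamma>\<^sub>u\<^esub> \<one>\<^bsub>\<Gamma>\<^sub>u\<^esub>" if "f \<in> F - {\<zero>\<^bsub>E\<^esub>}" for f
    using that V.valuation_ring_iff G.ord_total[of "\<one>\<^bsub>\<Gamma>\<^sub>v\<^esub>" "V.val f"] V.val_closed[OF that]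
      H.ord_quotient_le_imp[of "V.val f" "\<one>\<^bsub>\<Gamma>\<^sub>v\<^esub>"] uval[OF that] one_u Hone assms(5,12) by auto

  \<comment> \<open>\<open>W\<close> is the link between the two formulas: over \<open>R\<close> it
    matches the reduced filter map, and rewritten over \<open>R'\<close> it matches the filter
    quasi-valuation.\<close>
  define W where "W z = cut_plus \<Gamma>\<^sub>u (U.divisor_values R z)" for z
  have W': "W z = cut_plus \<Gamma>\<^sub>u (U.divisor_values R' z)" for z
  proof -
    have "S \<subseteq> R \<inter> F - {\<zero>\<^bsub>E\<^esub>}" using S(1) Ov(1,2) by blast
    from U.divisor_values_localization_in[OF assms(6) this S(2) uval_S]
    show ?thesis unfolding W_def R'_def by simp
  qed
  have reduced: "cut_plus \<Gamma>\<^sub>u ((\<lambda>a. H #>\<^bsub>\<Gamma>\<^sub>v\<^esub> V.val a) ` support_set E R O\<^sub>v x)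
      \<otimes>\<^bsub>cut_monoid \<Gamma>\<^sub>u\<^esub> cut_embed \<Gamma>\<^sub>u (H #>\<^bsub>\<Gamma>\<^sub>v\<^esub> inv\<^bsub>\<Gamma>\<^sub>v\<^esub> (V.val y)) = W (x \<otimes>\<^bsub>E\<^esub> inv\<^bsub>E\<^esub> y)"
    if x: "x \<in> R - {\<zero>\<^bsub>E\<^esub>}" and y: "y \<in> O\<^sub>v - {\<zero>\<^bsub>E\<^esub>}" for x y
  proof -
    have yF: "y \<in> F - {\<zero>\<^bsub>E\<^esub>}" using y Ov by auto
    have "H #>\<^bsub>\<Gamma>\<^sub>v\<^esub> inv\<^bsub>\<Gamma>\<^sub>v\<^esub> (V.val y) = inv\<^bsub>\<Gamma>\<^sub>u\<^esub> (U.val y)"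
      using H.inv_ord_quotient[OF V.val_closed[OF yF]] uval[OF yF] assms(12) by simp
    moreover have "(\<lambda>a. H #>\<^bsub>\<Gamma>\<^sub>v\<^esub> V.val a) ` support_set E R O\<^sub>v x = (\<lambda>a. U.val a) ` support_set E R O\<^sub>v x"
      using V.support_set_subset[OF Ov(2) R(1)] x uval by (intro image_cong) auto
    ultimately show ?thesis
      using U.cut_plus_support_set[OF assms(6) _ Ov(3) dichotomy' x y] assms(8) unfolding W_def by simp
  qed
  have ex_frac: "\<exists>x\<in>R - {\<zero>\<^bsub>E\<^esub>}. \<exists>y\<in>O\<^sub>v - {\<zero>\<^bsub>E\<^esub>}. z = x \<otimes>\<^bsub>E\<^esub> inv\<^bsub>E\<^esub> y"
    if z: "z \<in> carrier E - {\<zero>\<^bsub>E\<^esub>}" for z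
  proof -
    obtain x y where xy: "x \<in> R" "y \<in> O\<^sub>v - {\<zero>\<^bsub>E\<^esub>}" "z = x \<otimes>\<^bsub>E\<^esub> inv\<^bsub>E\<^esub> y"
      using z frac unfolding localization_in_def by blast
    have "inv\<^bsub>E\<^esub> y \<in> carrier E" using V.F_carrier V.F_inv xy(2) Ov(2) by blast
    then have "x \<noteq> \<zero>\<^bsub>E\<^esub>" using z xy(3) by auto
    then show ?thesis using xy by blast
  qed
  have frac_nz: "x \<otimes>\<^bsub>E\<^esub> inv\<^bsub>E\<^esub> y \<in> carrier E - {\<zero>\<^bsub>E\<^esub>}"
    if "x \<in> carrier E - {\<zero>\<^bsub>E\<^esub>}" "y \<in> carrier E - {\<zero>\<^bsub>E\<^esub>}" for x y
    using that E.inv_nonzero[of y] E.integral[of x "inv\<^bsub>E\<^esub> y"] by auto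
  have W_cut: "W z \<in> carrier (cut_monoid \<Gamma>\<^sub>u)" for z
    unfolding W_def cut_monoid_def
    using Gu.cut_plus_in_cuts[OF U.divisor_values_closed] by simp

  \<comment> \<open>Every nonzero \<open>z\<close> is a fraction of the required kind and
    \<open>W\<close> ignores the choice of it. The family of conditions therefore prescribes exactly
    one value at each \<open>z\<close>.\<close>
  have iff: "is_reduced_filter_map E F R \<Gamma>\<^sub>v v H w \<longleftrightarrow>
      w \<in> carrier E \<rightarrow>\<^sub>E with_infty_set (carrier (cut_monoid \<Gamma>\<^sub>u)) \<and> w \<zero>\<^bsub>E\<^esub> = Infty \<and>
      (\<forall>z\<in>carrier E - {\<zero>\<^bsub>E\<^esub>}. w z = Fin (W z))" for w
  proof -
    have "(\<forall>x\<in>R - {\<zero>\<^bsub>E\<^esub>}. \<forall>y\<in>O\<^sub>v - {\<zero>\<^bsub>E\<^esub>}. w (x \<otimes>\<^bsub>E\<^esub> inv\<^bsub>E\<^esub> y) = Fin (W (x \<otimes>\<^bsub>E\<^esub> inv\<^bsub>E\<^esub> y)))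
      \<longleftrightarrow> (\<forall>z\<in>carrier E - {\<zero>\<^bsub>E\<^esub>}. w z = Fin (W z))"
      (is "?L \<longleftrightarrow> ?R")
    proof
      assume L: ?L
      show ?R
      proof
        fix z assume "z \<in> carrier E - {\<zero>\<^bsub>E\<^esub>}"
        then show "w z = Fin (W z)" using ex_frac L by blast
      qed
    next
      assume ?R
      moreover have "x \<otimes>\<^bsub>E\<^esub> inv\<^bsub>E\<^esub> y \<in> carrier E - {\<zero>\<^bsub>E\<^esub>}"
        if "x \<in> R - {\<zero>\<^bsub>E\<^esub>}" "y \<in> O\<^sub>v - {\<zero>\<^bsub>E\<^esub>}" for x y
        using that R(1) Ov(1) by (intro frac_nz) auto
      ultimately show ?L by blast
    qed
    then show ?thesis
      unfolding is_reduced_filter_map_def Let_def assms(5,12)[symmetric] by (simp add: reduced)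
  qed
  have "\<exists>!w. is_reduced_filter_map E F R \<Gamma>\<^sub>v v H w"
  proof (rule ex_ex1I)
    \<comment> \<open>The restricted abstraction supplies the default value that extensionality
      demands outside \<open>carrier E\<close>.\<close>
    show "\<exists>w. is_reduced_filter_map E F R \<Gamma>\<^sub>v v H w"
      unfolding iff
      by (rule exI[of _ "\<lambda>z\<in>carrier E. if z = \<zero>\<^bsub>E\<^esub> then Infty else Fin (W z)"])
        (use W_cut in \<open>auto simp: with_infty_set_def\<close>)
    show "w = w'" if "is_reduced_filter_map E F R \<Gamma>\<^sub>v v H w" "is_reduced_filter_map E F R \<Gamma>\<^sub>v v H w'" for w w'
    proof (rule PiE_ext)
      show "w \<in> carrier E \<rightarrow>\<^sub>E with_infty_set (carrier (cut_monoid \<Gamma>\<^sub>u))"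
        "w' \<in> carrier E \<rightarrow>\<^sub>E with_infty_set (carrier (cut_monoid \<Gamma>\<^sub>u))" using that iff by auto
      show "w z = w' z" if "z \<in> carrier E" for z
        using \<open>is_reduced_filter_map E F R \<Gamma>\<^sub>v v H w\<close> \<open>is_reduced_filter_map E F R \<Gamma>\<^sub>v v H w'\<close> iff that
        by (cases "z = \<zero>\<^bsub>E\<^esub>") auto
    qed
  qed
  moreover have "is_filter_quasi_valuation E F R' \<Gamma>\<^sub>u u w"
    if w: "is_reduced_filter_map E F R \<Gamma>\<^sub>v v H w" for w
    unfolding is_filter_quasi_valuation_def Let_def
  proof (intro conjI ballI)
    show "is_fraction_field_of E R'"
      by (rule E.is_fraction_field_of_mono[OF assms(7) RR' subringE(1)[OF R']])
    fix r s assume r: "r \<in> R' - {\<zero>\<^bsub>E\<^esub>}"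
      and s: "s \<in> valuation_ring (E\<lparr>carrier := F\<rparr>) \<Gamma>\<^sub>u u - {\<zero>\<^bsub>E\<^esub>}"
    \<comment> \<open>The value at this fraction is known to be \<open>W\<close>, although
      \<open>r\<close> and \<open>s\<close> come from the localized rings. The support set lemma,
      now over \<open>R'\<close> and the valuation ring of \<open>u\<close>, turns it into the
      required formula.\<close>
    have "r \<otimes>\<^bsub>E\<^esub> inv\<^bsub>E\<^esub> s \<in> carrier E - {\<zero>\<^bsub>E\<^esub>}"
      using r s subringE(1)[OF R'] U.valuation_ring_subset F(1) by (intro frac_nz) auto
    then have "w (r \<otimes>\<^bsub>E\<^esub> inv\<^bsub>E\<^esub> s) = Fin (W (r \<otimes>\<^bsub>E\<^esub> inv\<^bsub>E\<^esub> s))" using w iff by blast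
    then show "w (r \<otimes>\<^bsub>E\<^esub> inv\<^bsub>E\<^esub> s) =
        Fin (cut_plus \<Gamma>\<^sub>u ((\<lambda>a. the_fin (u a)) ` support_set E R' (valuation_ring (E\<lparr>carrier := F\<rparr>) \<Gamma>\<^sub>u u) r)
          \<otimes>\<^bsub>cut_monoid \<Gamma>\<^sub>u\<^esub> cut_embed \<Gamma>\<^sub>u (inv\<^bsub>\<Gamma>\<^sub>u\<^esub> the_fin (u s)))"
      using U.cut_plus_support_set[OF R' _ U.one_in_valuation_ring dichotomy r s] R'F
      unfolding W' by simp
  qed (use u R' R'F w iff in auto)
  ultimately show ?thesis using u Ou unfolding R'_def by blast
qed

end
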